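(* Let $b\ge2$ and let $P_n$ be the internal path length and $W_n$ the Wiener index of a random $b$-ary recursive tree of size $n$ with edge weights $Z$, where $\|Z\|$ is bounded almost surely and $\mu:=E[Z_1]>0$. Then there exists a constant $D>0$ such that, with $\alpha:=\log\left(\frac{b\mu}{4D(b-1)e}\right)$, for every $t>0$, as $n\to\infty$, $$P\left(|P_n-E[P_n]|>tE[P_n]\right)\le\exp\left(-\frac{b}{b-1}\frac{\mu}{D}\,t\log n\left(\log^{(2)}n+\log t+\alpha+o(1)\right)\right)$$ and $$P\left(|W_n-E[W_n]|>tE[W_n]\right)\le\exp\left(-\frac{b}{b-1}\frac{\mu}{D}\,t\log n\left(\log^{(2)}n+\log t+\alpha+o(1)\right)\right).$$
   Context: $\log^{(2)}n=\log\log n$. The $o(1)$ is for $n\to\infty$ with $t$ fixed. Random $b$-ary recursive tree: in the infinite complete $b$-ary rooted ordered tree, start with the root as the only internal node and its $b$ children as external nodes. Given the tree with $n$ internal nodes, choose one of the current external nodes uniformly at random, turn it into an internal node, and add its $b$ children to the set of external nodes. The tree $T_n$ of size $n$ consists of the $n$ internal nodes. Edge weights: $Z=(Z_1,\ldots,Z_b)$ is a random vector with non-negative entries which are identically distributed (but may be dependent). To every node $u$ of the infinite $b$-ary tree attach an independent copy $Z^{(u)}$ of $Z$, the family being independent of the $T_n$; the entries of $Z^{(u)}$ are the weights of the edges from $u$ to its $b$ children. The distance between two nodes is the sum of the weights of the edges on the unique path between them; the depth of a node is its distance to the root. The internal path length $P_n$ is the sum of the depths of all $n$ nodes; the Wiener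 index $W_n$ is the sum of the distances over all unordered pairs of nodes. *)

theory Defs
  imports "HOL-Probability.Probability" "HOL-Library.Landau_Symbols" "HOL-Library.Sublist"
begin

text \<open>
  Nodes of the infinite complete b-ary ordered tree are addressed by the sequence of child
  indices on the way from the root \<open>[]\<close>; the children of \<open>u\<close> are \<open>u @ [i]\<close> for \<open>i < b\<close>,
  so entry number \<open>i + 1\<close> of a b-dimensional vector has index \<open>i\<close>.
\<close>

type_synonym node = "nat list"

definition nodes :: "nat \<Rightarrow> node set" where
  "nodes b = {u. set u \<subseteq> {..<b}}"

definition external :: "nat \<Rightarrow> node set \<Rightarrow> node set" where
  "external b T = {u @ [i] | u i. u \<in> T \<and> i < b} - T"

text \<open>The law of the set of internal nodes.\<close>

fun recursive_tree :: "nat \<Rightarrow> nat \<Rightarrow> node set pmf" where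
  "recursive_tree b 0 = return_pmf {}"
| "recursive_tree b (Suc 0) = return_pmf {[]}"
| "recursive_tree b (Suc (Suc n)) =
     bind_pmf (recursive_tree b (Suc n))
       (\<lambda>T. map_pmf (\<lambda>v. insert v T) (pmf_of_set (external b T)))"

text \<open>
  A weight assignment \<open>w\<close> gives the edge from \<open>u\<close> to its child \<open>u @ [i]\<close> the weight \<open>w u i\<close>.
  Paths are taken in the tree of all lists; the path joining two nodes only visits prefixes
  of these, so it stays inside the b-ary tree.
\<close>

definition adjacent :: "node \<Rightarrow> node \<Rightarrow> bool" where
  "adjacent u v \<longleftrightarrow> (\<exists>i. v = u @ [i] \<or> u = v @ [i])"

definition simple_path :: "node \<Rightarrow> node list \<Rightarrow> node \<Rightarrow> bool" where
  "simple_path u p v \<longleftrightarrow>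
     p \<noteq> [] \<and> hd p = u \<and> last p = v \<and> distinct p \<and> successively adjacent p"

definition edge_weight :: "(node \<Rightarrow> nat \<Rightarrow> real) \<Rightarrow> node \<Rightarrow> node \<Rightarrow> real" where
  "edge_weight w u v = (if length u < length v then w u (last v) else w v (last u))"

fun path_weight :: "(node \<Rightarrow> nat \<Rightarrow> real) \<Rightarrow> node list \<Rightarrow> real" where
  "path_weight w (u # v # p) = edge_weight w u v + path_weight w (v # p)"
| "path_weight w p = 0"

text \<open>The path is well defined by \<open>simple_path_unique\<close> below.\<close>

definition distance :: "(node \<Rightarrow> nat \<Rightarrow> real) \<Rightarrow> node \<Rightarrow> node \<Rightarrow> real" where
  "distance w u v = path_weight w (THE p. simple_path u p v)"

definition internal_path_length :: "node set \<times> (node \<Rightarrow> nat \<Rightarrow> real) \<Rightarrow> real" where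
  "internal_path_length = (\<lambda>(T, w). \<Sum>u\<in>T. distance w [] u)"

text \<open>Every unordered pair is counted twice in the sum over ordered pairs.\<close>

definition wiener_index :: "node set \<times> (node \<Rightarrow> nat \<Rightarrow> real) \<Rightarrow> real" where
  "wiener_index = (\<lambda>(T, w). (\<Sum>(u, v)\<in>{(u, v) \<in> T \<times> T. u \<noteq> v}. distance w u v) / 2)"

text \<open>
  The joint law of the tree of size \<open>n\<close> and the edge weights, where \<open>Q\<close>, a measure on
  \<open>PiM {..<b} (\<lambda>_. borel)\<close>, is the law of the weight vector of a single node.
\<close>

definition weighted_tree ::
    "nat \<Rightarrow> (nat \<Rightarrow> real) measure \<Rightarrow> nat \<Rightarrow> (node set \<times> (node \<Rightarrow> nat \<Rightarrow> real)) measure" where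
  "weighted_tree b Q n = measure_pmf (recursive_tree b n) \<Otimes>\<^sub>M PiM (nodes b) (\<lambda>_. Q)"

lemma adjacent_sym: "adjacent u v \<longleftrightarrow> adjacent v u"
  by (auto simp: adjacent_def)

lemma simple_path_rev: "simple_path u p v \<Longrightarrow> simple_path v (rev p) u"
  unfolding simple_path_def
  by (auto simp: hd_rev last_rev adjacent_sym)

lemma walk_leaves_subtree:
  assumes "successively adjacent p" "p \<noteq> []" "prefix (u @ [i]) (hd p)" "\<not> prefix (u @ [i]) (last p)"
  shows "u \<in> set p"
  using assms
proof (induction p)
  case Nil
  then show ?case by simp
next
  case (Cons x p)
  show ?case
  proof (cases p)
    case Nil
    then show ?thesis using Cons.prems by simp
  next
    case (Cons y q)
    have adj: "adjacent x y" and succ: "successively adjacent p"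
      using Cons.prems(1) Cons by auto
    show ?thesis
    proof (cases "prefix (u @ [i]) y")
      case True
      then show ?thesis using Cons.IH[OF succ] Cons.prems Cons by simp
    next
      case False
      obtain j where "y = x @ [j] \<or> x = y @ [j]"
        using adj by (auto simp: adjacent_def)
      then have "y = u"
        using False Cons.prems(3) by (auto simp: prefix_snoc)
      then show ?thesis using Cons by simp
    qed
  qed
qed

lemma simple_path_step:
  assumes "simple_path u p v" "\<not> prefix u v"
  shows "\<exists>q. p = u # q \<and> simple_path (butlast u) q v"
proof -
  obtain q where p: "p = u # q"
    using assms(1) by (cases p) (auto simp: simple_path_def)
  have "q \<noteq> []" using assms p by (auto simp: simple_path_def)
  then obtain y r where q: "q = y # r" by (cases q) auto
  have s: "successively adjacent q" "adjacent u y" "u \<notin> set q" "last q = v" "distinct q"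
    using assms(1) by (auto simp: simple_path_def p q)
  obtain j where "y = u @ [j] \<or> u = y @ [j]"
    using s(2) by (auto simp: adjacent_def)
  moreover have "y \<noteq> u @ [j]"
  proof
    assume y: "y = u @ [j]"
    have "\<not> prefix (u @ [j]) v"
      using assms(2) append_prefixD by blast
    then have "u \<in> set q"
      using walk_leaves_subtree[OF s(1), of u j] q y s(4) by auto
    then show False using s by simp
  qed
  ultimately have "y = butlast u" by auto
  then show ?thesis using p q s by (auto simp: simple_path_def)
qed

lemma simple_path_refl: "simple_path u p u \<longleftrightarrow> p = [u]"
  unfolding simple_path_def by (cases p) auto

lemma simple_path_inj: "simple_path u p v \<Longrightarrow> simple_path u q v \<Longrightarrow> p = q"
proof (induction "length u + length v" arbitrary: u v p q rule: less_induct)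
  case less
  show ?case
  proof (cases "prefix u v")
    case False
    then have l: "length (butlast u) + length v < length u + length v"
      by (cases u rule: rev_cases) auto
    obtain p' q' where "p = u # p'" "simple_path (butlast u) p' v"
        "q = u # q'" "simple_path (butlast u) q' v"
      using simple_path_step False less.prems by metis
    then show ?thesis using less.hyps[OF l] by blast
  next
    case True
    show ?thesis
    proof (cases "u = v")
      case True
      then show ?thesis using less.prems simple_path_refl by auto
    next
      case uv: False
      have np: "\<not> prefix v u" using True uv by (metis prefix_order.antisym)
      then have l: "length (butlast v) + length u < length u + length v"
        by (cases v rule: rev_cases) auto
      obtain p' q' where "rev p = v # p'" "simple_path (butlast v) p' u"
          "rev q = v # q'" "simple_path (butlast v) q' u"
        using simple_path_step[OF _ np] simple_path_rev less.prems by metis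
      then show ?thesis using less.hyps[OF l] by (metis rev_is_rev_conv)
    qed
  qed
qed

lemma simple_path_exists: "\<exists>p. simple_path u p v \<and> set p \<subseteq> {x. prefix x u \<or> prefix x v}"
proof (induction "length u + length v" arbitrary: u v rule: less_induct)
  case less
  have up: "\<exists>p. simple_path u p v \<and> set p \<subseteq> {x. prefix x u \<or> prefix x v}"
    if np: "\<not> prefix u v" and le: "length u + length v \<le> length u' + length v'"
      and IH: "\<And>u v :: node. length u + length v < length u' + length v' \<Longrightarrow>
        \<exists>p. simple_path u p v \<and> set p \<subseteq> {x. prefix x u \<or> prefix x v}"
    for u v u' v' :: node
  proof -
    obtain x i where u: "u = x @ [i]"
      using np by (cases u rule: rev_cases) auto
    obtain p where p: "simple_path x p v" "set p \<subseteq> {y. prefix y x \<or> prefix y v}"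
      using IH[of x v] le u by auto
    have "u \<notin> set p"
      using p(2) np u by (auto dest: prefix_length_le)
    then have "simple_path u (u # p) v"
      using p(1) u by (cases p) (auto simp: simple_path_def adjacent_def)
    moreover have "set (u # p) \<subseteq> {y. prefix y u \<or> prefix y v}"
      using p(2) u by auto
    ultimately show ?thesis by blast
  qed
  consider "\<not> prefix u v" | "\<not> prefix v u" | "u = v"
    using prefix_order.antisym by blast
  then show ?case
  proof cases
    case 1
    then show ?thesis using up[of u v u v] less by blast
  next
    case 2
    then obtain p where "simple_path v p u" "set p \<subseteq> {x. prefix x v \<or> prefix x u}"
      using up[of v u u v] less by auto
    then show ?thesis
      by (intro exI[of _ "rev p"]) (auto dest: simple_path_rev)
  next
    case 3
    then show ?thesis by (intro exI[of _ "[u]"]) (auto simp: simple_path_refl)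
  qed
qed

lemma simple_path_unique: "\<exists>!p. simple_path u p v"
  using simple_path_exists simple_path_inj by metis

text \<open>Both statistics are random variables on \<open>weighted_tree b Q n\<close>.\<close>

lemma edge_weight_measurable:
  fixes Q :: "(nat \<Rightarrow> real) measure"
  assumes "sets Q = sets (PiM {..<b} (\<lambda>_. borel))"
  shows "(\<lambda>w. w u i) \<in> borel_measurable (PiM (nodes b) (\<lambda>_. Q))"
proof (cases "u \<in> nodes b")
  case True
  have "(\<lambda>w. w u) \<in> PiM (nodes b) (\<lambda>_. Q) \<rightarrow>\<^sub>M PiM {..<b} (\<lambda>_. borel :: real measure)"
    using measurable_component_singleton[OF True, of "\<lambda>_. Q"]
    by (simp add: measurable_cong_sets[OF refl assms])
  moreover have "(\<lambda>z. z i) \<in> borel_measurable (PiM {..<b} (\<lambda>_. borel :: real measure))"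
  proof (cases "i < b")
    case False
    then have "z i = undefined" if "z \<in> space (PiM {..<b} (\<lambda>_. borel :: real measure))" for z
      using that by (auto simp: space_PiM PiE_def extensional_def)
    then show ?thesis by (subst measurable_cong[where g = "\<lambda>_. undefined"]) auto
  qed auto
  ultimately show ?thesis by (rule measurable_compose)
next
  case False
  then have "w u i = undefined i" if "w \<in> space (PiM (nodes b) (\<lambda>_. Q))" for w
    using that by (auto simp: space_PiM PiE_def extensional_def)
  then show ?thesis by (subst measurable_cong[where g = "\<lambda>_. undefined i"]) auto
qed

lemma distance_measurable:
  fixes Q :: "(nat \<Rightarrow> real) measure"
  assumes "sets Q = sets (PiM {..<b} (\<lambda>_. borel))"
  shows "(\<lambda>w. distance w u v) \<in> borel_measurable (PiM (nodes b) (\<lambda>_. Q))"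
proof -
  have "(\<lambda>w. path_weight w p) \<in> borel_measurable (PiM (nodes b) (\<lambda>_. Q))" for p
  proof (induction p rule: induct_list012)
    case (3 x y p)
    then show ?case
      using edge_weight_measurable[OF assms] by (simp add: edge_weight_def)
  qed auto
  then show ?thesis by (simp add: distance_def)
qed

lemma measurable_finite_tree:
  assumes f: "\<And>T. finite T \<Longrightarrow> (\<lambda>w. f (T, w)) \<in> borel_measurable N"
    and f0: "\<And>T w. infinite T \<Longrightarrow> f (T, w) = (0::real)"
  shows "f \<in> borel_measurable (measure_pmf (p :: node set pmf) \<Otimes>\<^sub>M N)"
proof -
  have F: "countable {T :: node set. finite T}"
    by (rule countable_Collect_finite)
  have "f -` B \<inter> space (measure_pmf p \<Otimes>\<^sub>M N) \<in> sets (measure_pmf p \<Otimes>\<^sub>M N)"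
    if B: "B \<in> sets borel" for B
  proof -
    have "f -` B \<inter> space (measure_pmf p \<Otimes>\<^sub>M N) =
        (\<Union>T\<in>{T. finite T}. {T} \<times> ((\<lambda>w. f (T, w)) -` B \<inter> space N)) \<union>
        (if 0 \<in> B then {T. infinite T} \<times> space N else {})"
      using f0 by (auto simp: space_pair_measure split: if_splits) metis+
    also have "\<dots> \<in> sets (measure_pmf p \<Otimes>\<^sub>M N)"
      using f B F
      by (intro sets.Un sets.countable_UN' pair_measureI) (auto intro!: pair_measureI measurable_sets)
    finally show ?thesis .
  qed
  then show ?thesis by (auto intro: measurableI)
qed

lemma internal_path_length_measurable:
  fixes Q :: "(nat \<Rightarrow> real) measure"
  assumes "sets Q = sets (PiM {..<b} (\<lambda>_. borel))"
  shows "internal_path_length \<in> borel_measurable (weighted_tree b Q n)"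
  unfolding weighted_tree_def
  by (rule measurable_finite_tree)
    (auto simp: internal_path_length_def intro!: borel_measurable_sum distance_measurable[OF assms])

lemma infinite_off_diagonal:
  assumes "infinite T"
  shows "infinite {(u, v) \<in> T \<times> T. u \<noteq> v}"
proof -
  obtain x where x: "x \<in> T" using assms by fastforce
  have "Pair x ` (T - {x}) \<subseteq> {(u, v) \<in> T \<times> T. u \<noteq> v}" using x by auto
  moreover have "infinite (Pair x ` (T - {x}))"
    using assms by (simp add: finite_image_iff inj_on_def)
  ultimately show ?thesis using finite_subset by blast
qed

lemma wiener_index_measurable:
  fixes Q :: "(nat \<Rightarrow> real) measure"
  assumes "sets Q = sets (PiM {..<b} (\<lambda>_. borel))"
  shows "wiener_index \<in> borel_measurable (weighted_tree b Q n)"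
  unfolding weighted_tree_def
proof (rule measurable_finite_tree)
  fix T :: "node set"
  assume "finite T"
  show "(\<lambda>w. wiener_index (T, w)) \<in> borel_measurable (PiM (nodes b) (\<lambda>_. Q))"
    unfolding wiener_index_def case_prod_beta
    by (auto intro!: borel_measurable_sum borel_measurable_divide distance_measurable[OF assms])
next
  fix T :: "node set" and w :: "node \<Rightarrow> nat \<Rightarrow> real"
  assume "infinite T"
  then show "wiener_index (T, w) = 0"
    using infinite_off_diagonal[of T] by (simp add: wiener_index_def)
qed

end

theory Submission
  imports Defs "HOL-Real_Asymp.Real_Asymp"
begin

text \<open>
  The constant \<open>D\<close> may be chosen freely, and enlarging it weakens both claims for large \<open>n\<close>. It therefore suffices to find
  some \<open>K > 0\<close>, the same for all \<open>t\<close>, such that for every \<open>t > 0\<close> and all large \<open>n\<close> both probabilities are at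
  most \<open>exp (- K * t * ln n * ln (ln n))\<close>: if \<open>D\<close> is chosen so that the prefactor of the exponent is half
  of \<open>K\<close>, the terms \<open>ln t + \<alpha>\<close> are eventually absorbed by \<open>ln (ln n)\<close>, and the error term can be
  taken to be zero (\<open>exponent_comparison\<close>).

  Let \<open>X\<close> be the sum of the depths of the \<open>m = (b - 1) * n + 1\<close> external nodes. Growing the tree at the external
  node \<open>v\<close> replaces \<open>v\<close> by \<open>b\<close> children, whose depths are that of \<open>v\<close> plus fresh weights. It follows that
  \<open>X / m\<close> minus a deterministic drift is a martingale, whose increments are \<open>O(B / n)\<close> as long as no external
  node lies deeper than \<open>B\<close>. The internal path length \<open>P\<close> satisfies \<open>(b - 1) * P = X - S\<close> with \<open>S\<close> the sum
  of all weights, and \<open>S = O(n)\<close> is negligible on the scale \<open>n * ln n\<close> of \<open>P\<close>. For the Wiener index,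
  \<open>W = n * P - R\<close> where \<open>R\<close> sums the depths of the last common ancestors of all pairs of nodes
  (\<open>wiener_index_eq\<close>). This \<open>R\<close> is at most a constant times the sum \<open>G\<close> of the overlaps of all pairs of external
  nodes, and \<open>G / m\<^sup>2\<close> is a supermartingale up to a mean increment \<open>O(B / n\<^sup>2)\<close>, again with increments
  \<open>O(B / n)\<close>.

  Such processes are treated together in the locale \<open>controlled_process\<close>. Their exponential moments
  with parameter \<open>\<theta>\<close> proportional to \<open>ln (ln n)\<close> are followed along the growth of the tree, starting at time
  \<open>M\<close> of order \<open>(ln n) ^ 3\<close> and cutting off at the height \<open>B = ln n * (ln (ln n))\<^sup>2\<close>. Up to time \<open>M\<close> the process
  is bounded by multiples of the height and of \<open>ln M\<close>, and \<open>profile_moment\<close> shows that this costs a factor \<open>exp (o(ln n))\<close>; after \<open>M\<close> the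
  squared increments, multiplied by \<open>\<theta>\<^sup>2\<close>, sum to \<open>o(1)\<close>, so that the factor is bounded; and the height exceeds \<open>B\<close> with probability
  \<open>exp (- ln n * (ln (ln n))\<^sup>2 * (1 + o(1)))\<close> at most. Markov's inequality yields
  \<open>exp (- K' * s * ln n * ln (ln n))\<close> for the probability of exceeding \<open>s * ln n\<close> (\<open>tail_asymptotic\<close>).

  This controls the deviation of \<open>P\<close> and \<open>W\<close> from a deterministic centre. The bound decays faster
  than any power of \<open>n\<close> while \<open>P\<close> and \<open>W\<close> grow polynomially, so the means are close to the centres
  (\<open>tail_about_mean\<close>), and these are at least \<open>\<mu> * n * ln n\<close> and \<open>\<mu> * n\<^sup>2 * ln n\<close>.
\<close>

section \<open>Growing trees\<close>

inductive grown :: "nat \<Rightarrow> nat \<Rightarrow> node set \<Rightarrow> bool" for b where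
  root: "grown b (Suc 0) {[]}"
| grow: "grown b n T \<Longrightarrow> v \<in> external b T \<Longrightarrow> grown b (Suc n) (insert v T)"

lemma grown_pos: "grown b n T \<Longrightarrow> n \<ge> 1"
  by (induction rule: grown.induct) auto

lemma grown_finite: "grown b n T \<Longrightarrow> finite T"
  by (induction rule: grown.induct) auto

lemma grown_card: "grown b n T \<Longrightarrow> card T = n"
  by (induction rule: grown.induct) (simp_all add: external_def card_insert_if grown_finite)

lemma external_subset_nodes: "T \<subseteq> nodes b \<Longrightarrow> external b T \<subseteq> nodes b"
  by (force simp: external_def nodes_def)

lemma grown_nodes: "grown b n T \<Longrightarrow> T \<subseteq> nodes b"
proof (induction rule: grown.induct)
  case root
  show ?case by (simp add: nodes_def)
next
  case (grow n T v)
  then show ?case using external_subset_nodes by blast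
qed

lemma external_nodes: "grown b n T \<Longrightarrow> external b T \<subseteq> nodes b"
  using grown_nodes external_subset_nodes by blast

lemma external_not_internal: "v \<in> external b T \<Longrightarrow> v \<notin> T"
  by (auto simp: external_def)

lemma grown_prefix_closed:
  assumes "grown b n T" "v \<in> T" "prefix u v"
  shows "u \<in> T"
  using assms
proof (induction arbitrary: v u rule: grown.induct)
  case (grow n T x)
  show ?case
  proof (cases "v = x \<and> u \<noteq> x")
    case True
    obtain y i where y: "x = y @ [i]" "y \<in> T"
      using grow.hyps by (auto simp: external_def)
    have "prefix u y"
      using True grow.prems(2) y(1) by (simp add: prefix_snoc)
    then show ?thesis using grow.IH[OF y(2)] by simp
  next
    case False
    then show ?thesis using grow by auto
  qed
qed auto

text \<open>
  An external node is a child of an internal one, so everything strictly above it is internal. Hence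
  external nodes are pairwise incomparable, which is why growing the tree at one of them leaves the
  depths of the others, and their common prefixes with it, untouched.
\<close>

lemma external_strict_prefix:
  assumes "grown b n T" "v \<in> external b T" "strict_prefix u v"
  shows "u \<in> T"
proof -
  obtain y i where y: "v = y @ [i]" "y \<in> T"
    using assms(2) by (auto simp: external_def)
  have "prefix u y"
    using assms(3) y(1) by (auto simp: strict_prefix_def prefix_snoc)
  then show ?thesis using grown_prefix_closed[OF assms(1) y(2)] by simp
qed

lemma external_not_prefix:
  assumes "grown b n T" "u \<in> external b T" "v \<in> external b T" "u \<noteq> v"
  shows "\<not> prefix u v"
  using external_strict_prefix[OF assms(1,3), of u] external_not_internal[OF assms(2)] assms(4)
  by (auto simp: strict_prefix_def)

lemma external_insert:
  assumes "grown b n T" "v \<in> external b T"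
  shows "external b (insert v T) = (external b T - {v}) \<union> (\<lambda>i. v @ [i]) ` {..<b}"
proof -
  have "v @ [i] \<notin> T" for i
    using grown_prefix_closed[OF assms(1), of "v @ [i]" v] external_not_internal[OF assms(2)] by auto
  then show ?thesis by (auto simp: external_def)
qed

lemma external_children_disjoint:
  assumes "v \<in> external b T"
  shows "external b T \<inter> (\<lambda>i. v @ [i]) ` {..<b} = {}"
  using external_not_internal[OF assms] by (auto simp: external_def)

lemma external_finite: "finite T \<Longrightarrow> finite (external b T)"
proof -
  have "external b T \<subseteq> (\<lambda>(u, i). u @ [i]) ` (T \<times> {..<b})"
    by (auto simp: external_def)
  then show "finite T \<Longrightarrow> finite (external b T)"
    by (rule finite_subset) auto
qed

text \<open>
  The growth rule for every additive statistic of the external nodes: the chosen node is replaced by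
  its children. The recursions for path lengths, overlaps and the profile are instances of it.
\<close>

lemma sum_external_insert:
  fixes f :: "node \<Rightarrow> real"
  assumes "grown b n T" "v \<in> external b T"
  shows "(\<Sum>u\<in>external b (insert v T). f u) =
    (\<Sum>u\<in>external b T. f u) - f v + (\<Sum>i<b. f (v @ [i]))"
proof -
  have fin: "finite (external b T)"
    using assms(1) by (simp add: external_finite grown_finite)
  have "(\<Sum>u\<in>external b (insert v T). f u) =
      (\<Sum>u\<in>external b T - {v}. f u) + (\<Sum>u\<in>(\<lambda>i. v @ [i]) ` {..<b}. f u)"
    unfolding external_insert[OF assms]
    using external_children_disjoint[OF assms(2)] fin by (intro sum.union_disjoint) auto
  also have "(\<Sum>u\<in>(\<lambda>i. v @ [i]) ` {..<b}. f u) = (\<Sum>i<b. f (v @ [i]))"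
    by (subst sum.reindex) (auto simp: inj_on_def)
  also have "(\<Sum>u\<in>external b T - {v}. f u) = (\<Sum>u\<in>external b T. f u) - f v"
    using fin assms(2) by (simp add: sum_diff1)
  finally show ?thesis .
qed

lemma external_root: "external b {[]} = (\<lambda>i. [i]) ` {..<b}"
  by (auto simp: external_def)

lemma sum_external_root: "(\<Sum>u\<in>external b {[]}. f u) = (\<Sum>i<b. f [i])"
  unfolding external_root by (subst sum.reindex) (auto simp: inj_on_def)

text \<open>
  The number of external nodes of a tree of size \<open>n\<close>.
\<close>

definition leaves :: "nat \<Rightarrow> nat \<Rightarrow> real" where
  "leaves b n = (real b - 1) * real n + 1"

lemma card_external: "grown b n T \<Longrightarrow> real (card (external b T)) = leaves b n"
proof (induction rule: grown.induct)
  case root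
  show ?case
    using sum_external_root[of "\<lambda>_. 1 :: nat" b] by (simp add: leaves_def)
next
  case (grow n T v)
  have "real (card (external b (insert v T))) = (\<Sum>u\<in>external b (insert v T). 1)"
    by simp
  also have "\<dots> = real (card (external b T)) - 1 + real b"
    by (subst sum_external_insert[OF grow.hyps]) simp
  finally show ?case using grow.IH by (simp add: leaves_def algebra_simps)
qed

lemma length_external_le: "grown b n T \<Longrightarrow> v \<in> external b T \<Longrightarrow> length v \<le> n"
proof (induction arbitrary: v rule: grown.induct)
  case (grow n T x)
  show ?case
    using grow.prems grow.IH[OF grow.hyps(2)] grow.IH[of v]
    unfolding external_insert[OF grow.hyps] by auto
qed (auto simp: external_root)

lemma length_internal_le: "grown b n T \<Longrightarrow> v \<in> T \<Longrightarrow> length v \<le> n"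
proof (induction arbitrary: v rule: grown.induct)
  case (grow n T x)
  show ?case
    using grow.prems length_external_le[OF grow.hyps] grow.IH[of v] by auto
qed auto

lemma external_nonempty:
  assumes "grown b n T" "b \<ge> 1"
  shows "external b T \<noteq> {}"
proof -
  have "0 < leaves b n" using assms(2) by (simp add: leaves_def add_nonneg_pos)
  then show ?thesis using card_external[OF assms(1)] by auto
qed

lemma leaves_Suc: "leaves b (Suc n) = leaves b n + (real b - 1)"
  by (simp add: leaves_def algebra_simps)

lemma leaves_ge: "b \<ge> 2 \<Longrightarrow> real n + 1 \<le> leaves b n"
  using mult_right_mono[of 1 "real b - 1" "real n"] by (simp add: leaves_def)

lemma leaves_le: "b \<ge> 1 \<Longrightarrow> n \<ge> 1 \<Longrightarrow> leaves b n \<le> real b * real n"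
  by (simp add: leaves_def algebra_simps)

lemma set_pmf_recursive_tree:
  assumes b: "b \<ge> 1" and "T \<in> set_pmf (recursive_tree b (Suc n))"
  shows "grown b (Suc n) T"
  using assms(2)
proof (induction n arbitrary: T)
  case (Suc n)
  then obtain T' v where T': "T' \<in> set_pmf (recursive_tree b (Suc n))" and
    v: "v \<in> set_pmf (pmf_of_set (external b T'))" "T = insert v T'"
    by auto
  have g: "grown b (Suc n) T'"
    using Suc.IH T' by simp
  have "v \<in> external b T'"
    using v(1) external_finite[OF grown_finite[OF g], of b] external_nonempty[OF g b] by simp
  then show ?case using g v(2) grown.grow by blast
qed (auto intro: grown.root)

section \<open>Depths and distances\<close>

definition depth :: "(node \<Rightarrow> nat \<Rightarrow> real) \<Rightarrow> node \<Rightarrow> real" where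
  "depth w v = (\<Sum>j<length v. w (take j v) (v ! j))"

lemma depth_Nil [simp]: "depth w [] = 0"
  by (simp add: depth_def)

lemma depth_snoc [simp]: "depth w (v @ [i]) = depth w v + w v i"
  by (simp add: depth_def nth_append)

lemma depth_cong:
  assumes "\<And>u. strict_prefix u v \<Longrightarrow> w u = w' u"
  shows "depth w v = depth w' v"
  unfolding depth_def
proof (intro sum.cong refl)
  fix j assume "j \<in> {..<length v}"
  then have "strict_prefix (take j v) v"
    by (auto simp: strict_prefix_def take_is_prefix)
  then show "w (take j v) (v ! j) = w' (take j v) (v ! j)"
    using assms by simp
qed

text \<open>
  Almost every weight assignment is of this kind; all pathwise estimates are made for these.
\<close>

definition admissible :: "nat \<Rightarrow> real \<Rightarrow> (node \<Rightarrow> nat \<Rightarrow> real) \<Rightarrow> bool" where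
  "admissible b C w \<longleftrightarrow> (\<forall>u\<in>nodes b. \<forall>i<b. 0 \<le> w u i \<and> w u i \<le> C)"

lemma depth_bounds:
  assumes "admissible b C w" "v \<in> nodes b"
  shows "0 \<le> depth w v" "depth w v \<le> C * length v"
proof -
  have *: "0 \<le> w (take j v) (v ! j) \<and> w (take j v) (v ! j) \<le> C" if "j < length v" for j
  proof -
    have "take j v \<in> nodes b" "v ! j < b"
      using assms(2) that set_take_subset[of j v] nth_mem[OF that] unfolding nodes_def by blast+
    then show ?thesis using assms(1) unfolding admissible_def by blast
  qed
  show "0 \<le> depth w v"
    unfolding depth_def by (rule sum_nonneg) (use * in auto)
  have "depth w v \<le> (\<Sum>j<length v. C)"
    unfolding depth_def by (rule sum_mono) (use * in auto)
  then show "depth w v \<le> C * length v" by (simp add: mult.commute)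
qed

abbreviation lcp :: "node \<Rightarrow> node \<Rightarrow> node" where
  "lcp \<equiv> longest_common_prefix"

lemma prefix_lcp_iff: "prefix x (lcp u v) \<longleftrightarrow> prefix x u \<and> prefix x v"
  by (blast intro: longest_common_prefix_max_prefix longest_common_prefix_prefix1
      longest_common_prefix_prefix2 prefix_order.trans)

text \<open>
  A node is determined by its prefixes.
\<close>

lemma lcp_eqI:
  assumes "\<And>x. prefix x u \<and> prefix x v \<longleftrightarrow> prefix x u' \<and> prefix x v'"
  shows "lcp u v = lcp u' v'"
proof -
  have "prefix x (lcp u v) \<longleftrightarrow> prefix x (lcp u' v')" for x
    unfolding prefix_lcp_iff by (rule assms)
  then show ?thesis by (meson prefix_order.antisym prefix_order.refl)
qed

lemma lcp_commute: "lcp u v = lcp v u"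
  by (rule lcp_eqI) blast

lemma lcp_snoc: "\<not> prefix (u @ [i]) v \<Longrightarrow> lcp (u @ [i]) v = lcp u v"
  by (rule lcp_eqI) (auto simp: prefix_snoc)

lemma lcp_self [simp]: "lcp u u = u"
  by (induction u) auto

lemma lcp_siblings: "i \<noteq> j \<Longrightarrow> lcp (u @ [i]) (u @ [j]) = u"
  by (induction u) auto

lemma path_weight_snoc:
  "p \<noteq> [] \<Longrightarrow> path_weight w (p @ [v]) = path_weight w p + edge_weight w (last p) v"
  by (induction p rule: induct_list012) simp_all

lemma edge_weight_sym: "adjacent u v \<Longrightarrow> edge_weight w u v = edge_weight w v u"
proof -
  have "edge_weight w x (x @ [i]) = edge_weight w (x @ [i]) x" for x i
    by (simp add: edge_weight_def)
  then show "adjacent u v \<Longrightarrow> edge_weight w u v = edge_weight w v u"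
    unfolding adjacent_def by metis
qed

lemma path_weight_rev: "successively adjacent p \<Longrightarrow> path_weight w (rev p) = path_weight w p"
proof (induction p rule: induct_list012)
  case (3 u v p)
  then have "path_weight w (rev (u # v # p)) = path_weight w (rev (v # p)) + edge_weight w v u"
    using path_weight_snoc[of "rev (v # p)" w u] by (simp add: last_rev)
  then show ?case using 3 edge_weight_sym[of u v w] by simp
qed auto

lemma distance_path: "simple_path u p v \<Longrightarrow> distance w u v = path_weight w p"
  unfolding distance_def by (rule arg_cong[OF the_equality]) (auto dest: simple_path_inj)

lemma distance_sym: "distance w u v = distance w v u"
proof -
  obtain p where p: "simple_path u p v" using simple_path_unique by metis
  have "distance w u v = path_weight w p" by (rule distance_path[OF p])
  also have "\<dots> = path_weight w (rev p)"
    using p by (simp add: path_weight_rev simple_path_def)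
  also have "\<dots> = distance w v u"
    by (rule distance_path[symmetric, OF simple_path_rev[OF p]])
  finally show ?thesis .
qed

text \<open>
  A path that starts at a child and ends outside its subtree must begin with the step to the parent.
\<close>

lemma distance_snoc:
  assumes "\<not> prefix (u @ [i]) v"
  shows "distance w (u @ [i]) v = w u i + distance w u v"
proof -
  obtain p where p: "simple_path (u @ [i]) p v" using simple_path_unique by metis
  obtain q where q: "p = (u @ [i]) # q" "simple_path u q v"
    using simple_path_step[OF p assms] by auto
  then obtain r where r: "q = u # r"
    by (cases q) (auto simp: simple_path_def)
  have "distance w (u @ [i]) v = path_weight w p" by (rule distance_path[OF p])
  also have "\<dots> = w u i + path_weight w q"
    using q(1) r by (simp add: edge_weight_def)
  also have "path_weight w q = distance w u v" by (rule distance_path[symmetric, OF q(2)])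
  finally show ?thesis .
qed

text \<open>
  The path descends to both nodes from their last common ancestor. Stripping the last step of
  whichever node is not an ancestor of the other one leads down to the case of equal nodes.
\<close>

lemma distance_eq_depth: "distance w u v = depth w u + depth w v - 2 * depth w (lcp u v)"
proof (induction "length u + length v" arbitrary: u v rule: less_induct)
  case less
  have up: "distance w u v = depth w u + depth w v - 2 * depth w (lcp u v)"
    if np: "\<not> prefix u v" and l: "length u + length v = length u' + length v'"
      and IH: "\<And>u v. length u + length v < length u' + length v' \<Longrightarrow>
        distance w u v = depth w u + depth w v - 2 * depth w (lcp u v)"
    for u v u' v'
  proof -
    obtain x i where u: "u = x @ [i]"
      using np by (cases u rule: rev_cases) auto
    have "distance w u v = w x i + distance w x v"
      using distance_snoc np u by simp
    then show ?thesis
      using IH[of x v] l u lcp_snoc np by simp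
  qed
  consider "\<not> prefix u v" | "\<not> prefix v u" | "u = v"
    using prefix_order.antisym by blast
  then show ?case
  proof cases
    case 1
    then show ?thesis using up[OF 1 refl less] by blast
  next
    case 2
    then show ?thesis
      using up[OF 2 add.commute less] distance_sym[of w u v] lcp_commute[of u v] by simp
  next
    case 3
    then show ?thesis
      using distance_path[of u "[u]" v w] by (simp add: simple_path_refl)
  qed
qed

lemma distance_root: "distance w [] u = depth w u"
  by (simp add: distance_eq_depth)

section \<open>External path length\<close>

definition external_path :: "nat \<Rightarrow> node set \<Rightarrow> (node \<Rightarrow> nat \<Rightarrow> real) \<Rightarrow> real" where
  "external_path b T w = (\<Sum>u\<in>external b T. depth w u)"

text \<open>
  The weights of a node enter only the depths of its strict descendants, and no external node is one
  of these.
\<close>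

lemma depth_fresh:
  assumes "grown b n T" "v \<in> external b T" "u \<in> external b T"
  shows "depth (w(v := z)) u = depth w u"
proof (rule depth_cong)
  fix x assume "strict_prefix x u"
  then have "x \<noteq> v"
    using external_not_prefix[OF assms] by (auto simp: strict_prefix_def)
  then show "(w(v := z)) x = w x" by simp
qed

lemma external_path_insert:
  assumes "grown b n T" "v \<in> external b T"
  shows "external_path b (insert v T) (w(v := z)) =
    external_path b T w + (real b - 1) * depth w v + (\<Sum>i<b. z i)"
proof -
  have "(\<Sum>u\<in>external b T. depth (w(v := z)) u) = external_path b T w"
    unfolding external_path_def by (intro sum.cong refl depth_fresh[OF assms])
  then show ?thesis
    using depth_fresh[OF assms assms(2), of w z]
    unfolding external_path_def
    by (subst sum_external_insert[OF assms]) (simp add: sum.distrib algebra_simps)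
qed

text \<open>
  Growing at \<open>v\<close> adds \<open>depth w v\<close> to the internal path length and \<open>b - 1\<close> times this amount, plus
  the weights of \<open>v\<close>, to the external one. The two path lengths thus agree up to the factor and the
  total of all weights, which is only linear in \<open>n\<close>.
\<close>

lemma internal_external_path:
  assumes "grown b n T"
  shows "(real b - 1) * (\<Sum>u\<in>T. depth w u) = external_path b T w - (\<Sum>u\<in>T. \<Sum>i<b. w u i)"
  using assms
proof (induction rule: grown.induct)
  case root
  have "depth w [i] = w [] i" for i
    using depth_snoc[of w "[]" i] by simp
  then show ?case
    unfolding external_path_def by (simp add: sum_external_root)
next
  case (grow n T v)
  have "external_path b (insert v T) w =
      external_path b T w + (real b - 1) * depth w v + (\<Sum>i<b. w v i)"
    using external_path_insert[OF grow.hyps, of w "w v"] by simp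
  moreover have "v \<notin> T" "finite T"
    using grow.hyps by (auto simp: external_not_internal grown_finite)
  ultimately show ?case
    using grow.IH by (simp add: algebra_simps)
qed

lemma external_path_bounds:
  assumes "grown b n T" "admissible b C w" "\<forall>u\<in>external b T. real (length u) \<le> x" "0 \<le> C"
  shows "0 \<le> external_path b T w" "external_path b T w \<le> leaves b n * (C * x)"
proof -
  have *: "0 \<le> depth w u \<and> depth w u \<le> C * x" if "u \<in> external b T" for u
  proof -
    have "C * real (length u) \<le> C * x"
      using assms(3,4) that by (intro mult_left_mono) auto
    then show ?thesis
      using depth_bounds[OF assms(2), of u] external_nodes[OF assms(1)] that by fastforce
  qed
  show "0 \<le> external_path b T w"
    unfolding external_path_def using * by (intro sum_nonneg) auto
  have "external_path b T w \<le> real (card (external b T)) * (C * x)"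
    unfolding external_path_def using * by (intro sum_bounded_above) auto
  then show "external_path b T w \<le> leaves b n * (C * x)"
    using card_external[OF assms(1)] by simp
qed

section \<open>Common prefixes\<close>

text \<open>
  The number of edges shared by the paths from the root to two nodes.
\<close>

definition overlap :: "node \<Rightarrow> node \<Rightarrow> real" where
  "overlap u v = real (length (lcp u v))"

definition overlaps :: "node set \<Rightarrow> real" where
  "overlaps A = (\<Sum>u\<in>A. \<Sum>v\<in>A. overlap u v)"

lemma overlap_nonneg [simp]: "0 \<le> overlap u v"
  by (simp add: overlap_def)

lemma overlap_self [simp]: "overlap u u = length u"
  by (simp add: overlap_def)

lemma overlap_commute: "overlap u v = overlap v u"
  by (simp add: overlap_def lcp_commute)

lemma overlap_le: "overlap u v \<le> length u"
  unfolding overlap_def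
  using prefix_length_le[OF longest_common_prefix_prefix1[of u v]] by simp

lemma lcp_child: "\<not> prefix (v @ [i]) u \<Longrightarrow> overlap u (v @ [i]) = overlap u v"
  using lcp_snoc[of v i u] by (simp add: overlap_def lcp_commute)

lemma overlap_child_external:
  assumes "grown b n T" "v \<in> external b T" "u \<in> external b T"
  shows "overlap u (v @ [i]) = overlap u v"
proof (rule lcp_child)
  show "\<not> prefix (v @ [i]) u"
    using external_not_prefix[OF assms(1,2,3)] append_prefixD[of v "[i]" u]
      prefix_length_le[of "v @ [i]" u] by (cases "u = v") auto
qed

lemma overlap_mono: "overlap u v \<le> overlap u (v @ [i])"
  unfolding overlap_def of_nat_le_iff
  by (rule prefix_length_le)
    (meson longest_common_prefix_max_prefix longest_common_prefix_prefix1
      longest_common_prefix_prefix2 prefix_prefix)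

lemma overlap_siblings: "i \<noteq> j \<Longrightarrow> overlap (v @ [i]) (v @ [j]) = length v"
  by (simp add: overlap_def lcp_siblings)

text \<open>
  With respect to any external node, including \<open>v\<close> itself, a child of \<open>v\<close> has the same overlap as \<open>v\<close>.
  Only the overlaps of the children of \<open>v\<close> among each other are new, and of these only the \<open>b\<close>
  diagonal ones exceed the length of \<open>v\<close>.
\<close>

lemma overlaps_external_insert:
  assumes "grown b n T" "v \<in> external b T"
  shows "overlaps (external b (insert v T)) =
    overlaps (external b T) + 2 * (real b - 1) * (\<Sum>y\<in>external b T. overlap v y)
    + (real b - 1)\<^sup>2 * length v + b"
proof -
  let ?E = "external b T"
  define S where "S x = (\<Sum>y\<in>?E. overlap x y)" for x
  define g where "g x = (\<Sum>y\<in>external b (insert v T). overlap x y)" for x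
  have g: "g x = S x - overlap x v + (\<Sum>i<b. overlap x (v @ [i]))" for x
    unfolding g_def S_def by (rule sum_external_insert[OF assms])
  have gE: "g x = S x + (real b - 1) * overlap x v" if "x \<in> ?E" for x
    unfolding g using overlap_child_external[OF assms that] by (simp add: algebra_simps)
  have gc: "g (v @ [j]) = S v + (real b - 1) * length v + 1" if "j < b" for j
  proof -
    have "S (v @ [j]) = S v"
      unfolding S_def
      using overlap_child_external[OF assms] overlap_commute by (intro sum.cong) auto
    moreover have "overlap (v @ [j]) v = length v"
      using overlap_child_external[OF assms assms(2)] overlap_commute[of "v @ [j]"] by simp
    moreover have "(\<Sum>i<b. overlap (v @ [j]) (v @ [i])) = (\<Sum>i<b. length v + (if i = j then 1 else 0))"
    proof -
      have "overlap (v @ [j]) (v @ [i]) = real (length v + (if i = j then 1 else 0))" for i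
        using overlap_siblings[of j i v] by auto
      then show ?thesis by simp
    qed
    moreover have "(\<Sum>i<b. length v + (if i = j then 1 else 0)) = b * length v + 1"
      using that by (simp add: sum.distrib sum.delta)
    ultimately show ?thesis unfolding g by (simp add: algebra_simps)
  qed
  have "overlaps (external b (insert v T)) = (\<Sum>x\<in>external b (insert v T). g x)"
    by (simp add: overlaps_def g_def)
  also have "\<dots> = (\<Sum>x\<in>?E. g x) - g v + (\<Sum>j<b. g (v @ [j]))"
    by (rule sum_external_insert[OF assms])
  also have "(\<Sum>x\<in>?E. g x) = overlaps ?E + (real b - 1) * S v"
    using gE overlap_commute[of v]
    by (simp add: sum.distrib overlaps_def S_def sum_distrib_left)
  also have "g v = S v + (real b - 1) * length v"
    using gE assms(2) by simp
  also have "(\<Sum>j<b. g (v @ [j])) = b * (S v + (real b - 1) * length v + 1)"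
    using gc by simp
  finally show ?thesis
    unfolding S_def by (simp add: algebra_simps power2_eq_square)
qed

text \<open>
  Both sides grow with the tree. When \<open>v\<close> becomes internal, it gains one term \<open>overlap x v\<close> on the left,
  while on the right it is replaced by \<open>b \<ge> 2\<close> children that overlap at least as much, a net gain of at
  least one such term.
\<close>

lemma sum_overlap_internal_le:
  assumes "grown b n T" "b \<ge> 2"
  shows "(\<Sum>u\<in>T. overlap x u) \<le> (\<Sum>y\<in>external b T. overlap x y)"
  using assms(1)
proof (induction rule: grown.induct)
  case root
  have "overlap x [] = 0"
    using overlap_le[of "[]" x] by (simp add: overlap_commute[of x] order_antisym)
  then show ?case by (simp add: sum_nonneg)
next
  case (grow n T v)
  have "2 * overlap x v \<le> real b * overlap x v"
    using assms(2) by (intro mult_right_mono) auto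
  also have "\<dots> \<le> (\<Sum>i<b. overlap x (v @ [i]))"
    using sum_bounded_below[of "{..<b}" "overlap x v" "\<lambda>i. overlap x (v @ [i])"]
    by (simp add: overlap_mono)
  finally have "overlap x v \<le> - overlap x v + (\<Sum>i<b. overlap x (v @ [i]))"
    by simp
  moreover have "v \<notin> T" "finite T"
    using grow.hyps by (auto simp: external_not_internal grown_finite)
  ultimately show ?case
    using grow.IH by (simp add: sum_external_insert[OF grow.hyps])
qed

text \<open>
  The external overlaps have computable conditional means, the internal ones do not; this is how the
  former come to control the correction term in the Wiener index. A growth step at \<open>v\<close> adds twice the
  overlaps with \<open>v\<close> and the length of \<open>v\<close> on the left, and no less on the right.
\<close>

lemma overlaps_internal_le:
  assumes "grown b n T" "b \<ge> 2"
  shows "overlaps T \<le> overlaps (external b T)"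
  using assms(1)
proof (induction rule: grown.induct)
  case root
  show ?case by (simp add: overlaps_def sum_nonneg)
next
  case (grow n T v)
  have v: "v \<notin> T" "finite T"
    using grow.hyps by (auto simp: external_not_internal grown_finite)
  have "overlaps (insert v T) = overlaps T + 2 * (\<Sum>u\<in>T. overlap v u) + length v"
    using v overlap_commute[of v] by (simp add: overlaps_def sum.distrib)
  also have "\<dots> \<le> overlaps (external b T) + 2 * (\<Sum>u\<in>external b T. overlap v u) + length v"
    using grow.IH sum_overlap_internal_le[OF grow.hyps(1) assms(2), of v] by linarith
  also have "\<dots> \<le> overlaps (external b T) + 2 * (real b - 1) * (\<Sum>u\<in>external b T. overlap v u)
      + (real b - 1)\<^sup>2 * length v + b"
  proof -
    have "1 * (\<Sum>u\<in>external b T. overlap v u) \<le> (real b - 1) * (\<Sum>u\<in>external b T. overlap v u)"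
      using assms(2) by (intro mult_right_mono sum_nonneg) auto
    moreover have "1 * real (length v) \<le> (real b - 1)\<^sup>2 * length v"
      using assms(2) by (intro mult_right_mono one_le_power) auto
    ultimately show ?thesis by (simp only: mult.assoc)
  qed
  finally show ?case
    by (simp only: overlaps_external_insert[OF grow.hyps])
qed

text \<open>
  Summing \<open>distance_eq_depth\<close> over all ordered pairs: the Wiener index is \<open>n\<close> times the path length up to
  a correction that collects the depths of the last common ancestors.
\<close>

lemma wiener_index_eq:
  assumes "finite T"
  shows "wiener_index (T, w) =
    card T * internal_path_length (T, w) - (\<Sum>u\<in>T. \<Sum>v\<in>T. depth w (lcp u v))"
proof -
  have "(\<Sum>(u, v)\<in>{(u, v) \<in> T \<times> T. u \<noteq> v}. distance w u v) = (\<Sum>(u, v)\<in>T \<times> T. distance w u v)"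
    using assms by (intro sum.mono_neutral_left) (auto simp: distance_eq_depth)
  also have "\<dots> = (\<Sum>u\<in>T. \<Sum>v\<in>T. depth w u + depth w v - 2 * depth w (lcp u v))"
    by (simp add: sum.cartesian_product distance_eq_depth)
  also have "\<dots> = 2 * (card T * (\<Sum>u\<in>T. depth w u) - (\<Sum>u\<in>T. \<Sum>v\<in>T. depth w (lcp u v)))"
    by (simp add: sum.distrib sum_subtractf sum_distrib_left[symmetric] algebra_simps)
  finally show ?thesis
    by (simp add: wiener_index_def internal_path_length_def distance_root)
qed

lemma sum_depth_lcp_bounds:
  assumes "grown b n T" "b \<ge> 2" "admissible b C w" "0 \<le> C"
  shows "0 \<le> (\<Sum>u\<in>T. \<Sum>v\<in>T. depth w (lcp u v))"
    "(\<Sum>u\<in>T. \<Sum>v\<in>T. depth w (lcp u v)) \<le> C * overlaps (external b T)"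
proof -
  have *: "0 \<le> depth w (lcp u v) \<and> depth w (lcp u v) \<le> C * overlap u v" if "u \<in> T" for u v
  proof -
    have "lcp u v \<in> T"
      using grown_prefix_closed[OF assms(1) that] longest_common_prefix_prefix1 by blast
    then have "lcp u v \<in> nodes b"
      using grown_nodes[OF assms(1)] by blast
    then show ?thesis
      using depth_bounds[OF assms(3)] by (auto simp: overlap_def)
  qed
  show "0 \<le> (\<Sum>u\<in>T. \<Sum>v\<in>T. depth w (lcp u v))"
    using * by (intro sum_nonneg) auto
  have "(\<Sum>u\<in>T. \<Sum>v\<in>T. depth w (lcp u v)) \<le> (\<Sum>u\<in>T. \<Sum>v\<in>T. C * overlap u v)"
    using * by (intro sum_mono) auto
  also have "\<dots> = C * overlaps T"
    by (simp add: overlaps_def sum_distrib_left)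
  also have "\<dots> \<le> C * overlaps (external b T)"
    using overlaps_internal_le[OF assms(1,2)] assms(4) by (rule mult_left_mono)
  finally show "(\<Sum>u\<in>T. \<Sum>v\<in>T. depth w (lcp u v)) \<le> C * overlaps (external b T)" .
qed

section \<open>Growing the tree and its weights together\<close>

lemma exp_le_quadratic:
  fixes x :: real
  assumes "\<bar>x\<bar> \<le> 1"
  shows "exp x \<le> 1 + x + 2 * x\<^sup>2"
proof -
  obtain t where t: "\<bar>t\<bar> \<le> \<bar>x\<bar>" "exp x = (\<Sum>m<2. x ^ m / fact m) + exp t / fact 2 * x ^ 2"
    using Maclaurin_exp_le[of x 2] by blast
  have "exp t \<le> exp 1" using t(1) assms by simp
  then have "exp t \<le> 4" using exp_le by linarith
  then have "exp t / 2 * x\<^sup>2 \<le> 2 * x\<^sup>2" by (intro mult_right_mono) auto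
  then show ?thesis using t(2) by (simp add: numeral_2_eq_2)
qed

text \<open>
  \<open>Q\<close> is the law of the weight vector of one node. Taking the bound \<open>C\<close> at least 1 lets it dominate
  products in which it appears with lengths and constants.
\<close>

locale weighted_recursive_tree =
  fixes b :: nat and Q :: "(nat \<Rightarrow> real) measure" and C \<mu> :: real
  assumes b: "b \<ge> 2"
    and Q: "prob_space Q"
    and sets_Q: "sets Q = sets (PiM {..<b} (\<lambda>_. borel))"
    and Q_bounds: "AE z in Q. \<forall>i<b. 0 \<le> z i \<and> z i \<le> C"
    and C: "C \<ge> 1"
    and mean: "\<And>i. i < b \<Longrightarrow> (LINT z|Q. z i) = \<mu>"
    and mu_pos: "\<mu> > 0"
begin

sublocale Q: prob_space Q by (rule Q)

definition \<W> :: "(node \<Rightarrow> nat \<Rightarrow> real) measure" where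
  "\<W> = PiM (nodes b) (\<lambda>_. Q)"

sublocale \<W>: prob_space \<W>
  unfolding \<W>_def by (rule prob_space_PiM) (rule Q)

text \<open>
  The expectation of a nonnegative statistic of the tree and the weights, written as an iterated
  integral so that conditioning on the tree means looking at the inner integral.
\<close>

definition expect :: "nat \<Rightarrow> (node set \<Rightarrow> (node \<Rightarrow> nat \<Rightarrow> real) \<Rightarrow> ennreal) \<Rightarrow> ennreal" where
  "expect n f = (\<integral>\<^sup>+T. \<integral>\<^sup>+w. f T w \<partial>\<W> \<partial>measure_pmf (recursive_tree b n))"

lemma AE_admissible: "AE w in \<W>. admissible b C w"
proof -
  have "AE w in \<W>. \<forall>i<b. 0 \<le> w u i \<and> w u i \<le> C" if "u \<in> nodes b" for u
    unfolding \<W>_def by (rule AE_PiM_component[OF _ that Q_bounds]) (rule Q)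
  then show ?thesis
    unfolding admissible_def by (subst AE_ball_countable) auto
qed

lemma component_measurable: "i < b \<Longrightarrow> (\<lambda>z. z i) \<in> borel_measurable Q"
  unfolding measurable_cong_sets[OF sets_Q refl] by simp

lemma component_integrable:
  assumes "i < b"
  shows "integrable Q (\<lambda>z. z i)"
proof (rule Q.integrable_const_bound[where B = C])
  show "AE z in Q. norm (z i) \<le> C"
    using Q_bounds by eventually_elim (use assms in auto)
qed (rule component_measurable[OF assms])

lemma mu_le: "\<mu> \<le> C"
proof -
  have "(LINT z|Q. z 0) \<le> (LINT z|Q. C)"
    using b Q_bounds by (intro integral_mono_AE component_integrable) (auto elim: eventually_mono)
  then show ?thesis using mean[of 0] b by (simp add: Q.prob_space)
qed

lemma weight_measurable [measurable]: "(\<lambda>w. w u i) \<in> borel_measurable \<W>"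
  unfolding \<W>_def by (rule edge_weight_measurable[OF sets_Q])

lemma depth_measurable [measurable]: "(\<lambda>w. depth w u) \<in> borel_measurable \<W>"
  unfolding depth_def by measurable

lemma update_measurable:
  assumes "v \<in> nodes b"
  shows "(\<lambda>(w, z). w(v := z)) \<in> \<W> \<Otimes>\<^sub>M Q \<rightarrow>\<^sub>M \<W>"
  using measurable_add_dim[of v "nodes b" "\<lambda>_. Q"] assms
  by (simp add: \<W>_def insert_absorb)

text \<open>
  The coordinates of a product measure are independent, so the weights of one node can be replaced by a
  fresh draw from \<open>Q\<close>.
\<close>

lemma resample:
  assumes v: "v \<in> nodes b" and f: "f \<in> borel_measurable \<W>"
  shows "(\<integral>\<^sup>+w. f w \<partial>\<W>) = (\<integral>\<^sup>+w. \<integral>\<^sup>+z. f (w(v := z)) \<partial>Q \<partial>\<W>)"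
proof -
  interpret P: pair_sigma_finite Q \<W> ..
  have swap: "(\<lambda>(z, w). w(v := z)) \<in> Q \<Otimes>\<^sub>M \<W> \<rightarrow>\<^sub>M \<W>"
    using measurable_pair_swap[OF update_measurable[OF v]] by (simp add: case_prod_unfold)
  have "\<W> = distr (Q \<Otimes>\<^sub>M \<W>) \<W> (\<lambda>(z, w). w(v := z))"
    using distr_pair_PiM_eq_PiM[of "nodes b" "\<lambda>_. Q" v] v Q
    by (simp add: \<W>_def insert_absorb)
  then have "(\<integral>\<^sup>+w. f w \<partial>\<W>) = (\<integral>\<^sup>+w. f w \<partial>distr (Q \<Otimes>\<^sub>M \<W>) \<W> (\<lambda>(z, w). w(v := z)))"
    by simp
  also have "\<dots> = (\<integral>\<^sup>+p. f (case p of (z, w) \<Rightarrow> w(v := z)) \<partial>(Q \<Otimes>\<^sub>M \<W>))"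
    by (rule nn_integral_distr[OF swap]) (use f in simp)
  also have "\<dots> = (\<integral>\<^sup>+w. \<integral>\<^sup>+z. f (w(v := z)) \<partial>Q \<partial>\<W>)"
    using P.nn_integral_snd[OF measurable_compose[OF swap f]] by simp
  finally show ?thesis .
qed

lemma update_integral_measurable:
  assumes v: "v \<in> nodes b" and f: "f \<in> borel_measurable \<W>"
  shows "(\<lambda>w. \<integral>\<^sup>+z. f (w(v := z)) \<partial>Q) \<in> borel_measurable \<W>"
  using Q.borel_measurable_nn_integral_fst[OF measurable_compose[OF update_measurable[OF v] f]]
  by simp

lemma expect_mono:
  assumes "\<And>T w. grown b n T \<Longrightarrow> admissible b C w \<Longrightarrow> w \<in> space \<W> \<Longrightarrow> f T w \<le> g T w" "n \<ge> 1"
  shows "expect n f \<le> expect n g"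
  unfolding expect_def
proof (rule nn_integral_mono_AE, rule AE_pmfI)
  fix T assume "T \<in> set_pmf (recursive_tree b n)"
  then have T: "grown b n T"
    using set_pmf_recursive_tree[of b T "n - 1"] b assms(2) by simp
  show "(\<integral>\<^sup>+w. f T w \<partial>\<W>) \<le> (\<integral>\<^sup>+w. g T w \<partial>\<W>)"
    using AE_admissible AE_space
    by (intro nn_integral_mono_AE, eventually_elim) (use assms(1) T in auto)
qed

lemma expect_root: "expect (Suc 0) f = (\<integral>\<^sup>+w. f {[]} w \<partial>\<W>)"
  by (simp add: expect_def)

text \<open>
  One step of the growth process. At an external node \<open>v\<close> the weights have not influenced the past, so
  they may be resampled: conditionally on a tree of size \<open>n\<close> and its weights, the next state is
  \<open>(insert v T, w(v := z))\<close> with \<open>v\<close> uniform among the external nodes and \<open>z\<close> drawn from \<open>Q\<close>. The premise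
  bounds the sum over \<open>v\<close>, i.e. the number of leaves times the conditional mean.
\<close>

lemma expect_Suc_le:
  assumes f: "\<And>T. f T \<in> borel_measurable \<W>" and n: "n \<ge> 1"
    and le: "\<And>T w. grown b n T \<Longrightarrow> admissible b C w \<Longrightarrow> w \<in> space \<W> \<Longrightarrow>
      (\<Sum>v\<in>external b T. \<integral>\<^sup>+z. f (insert v T) (w(v := z)) \<partial>Q) \<le> ennreal (leaves b n) * g T w"
  shows "expect (Suc n) f \<le> expect n g"
proof -
  obtain k where k: "n = Suc k" using n by (cases n) auto
  have "expect (Suc n) f = (\<integral>\<^sup>+T. (\<integral>\<^sup>+v. (\<integral>\<^sup>+w. f (insert v T) w \<partial>\<W>)
      \<partial>measure_pmf (pmf_of_set (external b T))) \<partial>measure_pmf (recursive_tree b n))"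
    unfolding expect_def k by simp
  also have "\<dots> \<le> expect n g"
    unfolding expect_def
  proof (rule nn_integral_mono_AE, rule AE_pmfI)
    fix T assume "T \<in> set_pmf (recursive_tree b n)"
    then have T: "grown b n T"
      using set_pmf_recursive_tree[of b T k] b k by simp
    define m where "m = card (external b T)"
    have fin: "finite (external b T)" and ne: "external b T \<noteq> {}"
      using external_finite[OF grown_finite[OF T]] external_nonempty[OF T] b by auto
    then have m: "m > 0" unfolding m_def by (simp add: card_gt_0_iff)
    have mr: "real m = leaves b n" unfolding m_def by (rule card_external[OF T])
    have nodes: "v \<in> nodes b" if "v \<in> external b T" for v
      using external_nodes[OF T] that by blast
    have "(\<integral>\<^sup>+v. (\<integral>\<^sup>+w. f (insert v T) w \<partial>\<W>) \<partial>measure_pmf (pmf_of_set (external b T))) =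
        (\<Sum>v\<in>external b T. \<integral>\<^sup>+w. f (insert v T) w \<partial>\<W>) / m"
      unfolding m_def by (rule nn_integral_pmf_of_set[OF ne fin])
    also have "(\<Sum>v\<in>external b T. \<integral>\<^sup>+w. f (insert v T) w \<partial>\<W>) =
        (\<Sum>v\<in>external b T. \<integral>\<^sup>+w. \<integral>\<^sup>+z. f (insert v T) (w(v := z)) \<partial>Q \<partial>\<W>)"
      by (intro sum.cong refl resample nodes f)
    also have "\<dots> = (\<integral>\<^sup>+w. (\<Sum>v\<in>external b T. \<integral>\<^sup>+z. f (insert v T) (w(v := z)) \<partial>Q) \<partial>\<W>)"
      by (intro nn_integral_sum[symmetric] update_integral_measurable nodes f)
    also have "\<dots> / m = (\<integral>\<^sup>+w. (\<Sum>v\<in>external b T. \<integral>\<^sup>+z. f (insert v T) (w(v := z)) \<partial>Q) / m \<partial>\<W>)"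
      by (intro nn_integral_divide[symmetric] borel_measurable_sum update_integral_measurable nodes f)
    also have "\<dots> \<le> (\<integral>\<^sup>+w. g T w \<partial>\<W>)"
    proof (rule nn_integral_mono_AE)
      show "AE w in \<W>. (\<Sum>v\<in>external b T. \<integral>\<^sup>+z. f (insert v T) (w(v := z)) \<partial>Q) / m \<le> g T w"
        using AE_admissible AE_space
      proof eventually_elim
        case (elim w)
        have "(\<Sum>v\<in>external b T. \<integral>\<^sup>+z. f (insert v T) (w(v := z)) \<partial>Q) \<le> of_nat m * g T w"
          using le[OF T elim] by (simp add: ennreal_of_nat_eq_real_of_nat mr)
        then have "(\<Sum>v\<in>external b T. \<integral>\<^sup>+z. f (insert v T) (w(v := z)) \<partial>Q) / m
            \<le> (of_nat m * g T w) / m"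
          by (rule divide_right_mono_ennreal)
        also have "\<dots> = g T w"
          using m by (subst mult.commute, subst ennreal_mult_divide_eq) auto
        finally show ?case .
      qed
    qed
    finally show "(\<integral>\<^sup>+v. (\<integral>\<^sup>+w. f (insert v T) w \<partial>\<W>) \<partial>measure_pmf (pmf_of_set (external b T)))
        \<le> (\<integral>\<^sup>+w. g T w \<partial>\<W>)" .
  qed
  finally show ?thesis .
qed

lemma expect_cmult:
  assumes "\<And>T. f T \<in> borel_measurable \<W>"
  shows "expect n (\<lambda>T w. c * f T w) = c * expect n f"
  unfolding expect_def by (simp add: nn_integral_cmult assms)

lemma leaves_pos: "0 < leaves b n"
  using leaves_ge[OF b, of n] by linarith

section \<open>Exponential moments of the profile\<close>

text \<open>
  Growing at \<open>v\<close> adds at most \<open>b * exp \<theta> * exp (\<theta> * length v)\<close> to the sum, so that its mean grows by at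
  most the factor \<open>1 + b * exp \<theta> / n\<close> in a step; the product of these factors is bounded through the
  harmonic numbers. Since the sum dominates the exponential of \<open>\<theta>\<close> times the height, the lemma serves
  both as a tail bound for the height and as the start of the exponential moment estimate below.
\<close>

lemma profile_moment:
  fixes \<theta> :: real
  assumes "n \<ge> 1"
  shows "expect n (\<lambda>T w. ennreal (\<Sum>v\<in>external b T. exp (\<theta> * length v)))
    \<le> ennreal (exp (2 * b * exp \<theta> * (1 + ln n)))"
proof -
  let ?f = "\<lambda>T (w :: node \<Rightarrow> nat \<Rightarrow> real). ennreal (\<Sum>v\<in>external b T. exp (\<theta> * length v))"
  let ?a = "real b * exp \<theta>"
  have a: "0 < ?a" using b by simp
  have "expect n ?f \<le> ennreal (?a * exp (?a * (\<Sum>k=1..<n. 1 / k)))"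
    using assms
  proof (induction n rule: dec_induct)
    case base
    have "?f {[]} w = ennreal ?a" for w
      by (simp add: sum_external_root)
    then show ?case by (simp add: expect_root \<W>.emeasure_space_1)
  next
    case (step n)
    have n: "n \<ge> 1" using step by simp
    have "expect (Suc n) ?f \<le> expect n (\<lambda>T w. ennreal (1 + ?a / n) * ?f T w)"
    proof (rule expect_Suc_le[OF _ n])
      fix T w assume T: "grown b n T"
      let ?S = "\<Sum>v\<in>external b T. exp (\<theta> * length v)"
      have le: "(\<Sum>u\<in>external b (insert v T). exp (\<theta> * length u)) \<le> ?S + ?a * exp (\<theta> * length v)"
        if "v \<in> external b T" for v
        by (subst sum_external_insert[OF T that]) (simp add: ring_distribs exp_add)
      have "(\<Sum>v\<in>external b T. ?S + ?a * exp (\<theta> * length v)) = (leaves b n + ?a) * ?S"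
        using card_external[OF T] by (simp add: sum.distrib sum_distrib_left[symmetric] algebra_simps)
      also have "\<dots> \<le> leaves b n * (1 + ?a / n) * ?S"
      proof -
        have "?a * n \<le> ?a * leaves b n"
          using leaves_ge[OF b, of n] a by (intro mult_left_mono) auto
        then have "leaves b n + ?a \<le> leaves b n * (1 + ?a / n)"
          using n by (simp add: field_simps)
        then show ?thesis
          by (rule mult_right_mono) (simp add: sum_nonneg)
      qed
      finally have sum_le: "(\<Sum>v\<in>external b T. ?S + ?a * exp (\<theta> * length v))
          \<le> leaves b n * (1 + ?a / n) * ?S" .
      have "(\<Sum>v\<in>external b T. \<integral>\<^sup>+z. ?f (insert v T) (w(v := z)) \<partial>Q) =
          (\<Sum>v\<in>external b T. ?f (insert v T) w)"
        by (simp add: Q.emeasure_space_1)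
      also have "\<dots> \<le> (\<Sum>v\<in>external b T. ennreal (?S + ?a * exp (\<theta> * length v)))"
        by (intro sum_mono ennreal_leI le)
      also have "\<dots> = ennreal (\<Sum>v\<in>external b T. ?S + ?a * exp (\<theta> * length v))"
        by (intro sum_ennreal add_nonneg_nonneg sum_nonneg) auto
      also have "\<dots> \<le> ennreal (leaves b n * (1 + ?a / n) * ?S)"
        by (rule ennreal_leI) (rule sum_le)
      also have "\<dots> = ennreal (leaves b n) * (ennreal (1 + ?a / n) * ?f T w)"
        using leaves_pos[of n] a by (simp only: ennreal_mult' sum_nonneg mult.assoc less_imp_le
            zero_le_divide_iff of_nat_0_le_iff add_nonneg_nonneg zero_le_one simp_thms)
      finally show "(\<Sum>v\<in>external b T. \<integral>\<^sup>+z. ?f (insert v T) (w(v := z)) \<partial>Q)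
          \<le> ennreal (leaves b n) * (ennreal (1 + ?a / n) * ?f T w)" .
    qed simp
    also have "\<dots> = ennreal (1 + ?a / n) * expect n ?f"
      by (rule expect_cmult) simp
    also have "\<dots> \<le> ennreal (exp (?a / n)) * ennreal (?a * exp (?a * (\<Sum>k=1..<n. 1 / k)))"
      using step.IH by (intro mult_mono ennreal_leI exp_ge_add_one_self) auto
    also have "\<dots> = ennreal (?a * exp (?a * (\<Sum>k=1..<Suc n. 1 / k)))"
      using n a by (subst ennreal_mult[symmetric]) (auto simp: algebra_simps exp_add)
    finally show ?case .
  qed
  also have "\<dots> \<le> ennreal (exp (2 * ?a * (1 + ln n)))"
  proof (rule ennreal_leI)
    have "(\<Sum>k=1..<n. 1 / real k) \<le> (\<Sum>k=1..n. 1 / real k)"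
      by (intro sum_mono2) auto
    also have "\<dots> = harm n"
      by (simp add: harm_def inverse_eq_divide)
    also have "\<dots> \<le> ln n + 1"
      using euler_mascheroni_sequence_decreasing[of 1 n] assms by (simp add: harm_expand)
    finally have h: "(\<Sum>k=1..<n. 1 / real k) \<le> 1 + ln n" by simp
    have "?a \<le> exp ?a" using exp_ge_add_one_self[of ?a] by linarith
    then have "?a * exp (?a * (\<Sum>k=1..<n. 1 / k)) \<le> exp ?a * exp (?a * (1 + ln n))"
      using h a by (intro mult_mono iffD2[OF exp_le_cancel_iff] mult_left_mono) auto
    also have "\<dots> = exp (?a + ?a * (1 + ln n))" by (simp add: exp_add)
    also have "\<dots> \<le> exp (2 * ?a * (1 + ln n))"
      using a assms by (simp add: algebra_simps)
    finally show "?a * exp (?a * (\<Sum>k=1..<n. 1 / k)) \<le> exp (2 * ?a * (1 + ln n))" .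
  qed
  finally show ?thesis by (simp add: mult.assoc)
qed

end

section \<open>Tail bounds for controlled processes\<close>

text \<open>
  Bounded height, expressed through the external nodes.
\<close>

definition shallow :: "nat \<Rightarrow> real \<Rightarrow> node set \<Rightarrow> bool" where
  "shallow b B T \<longleftrightarrow> (\<forall>u\<in>external b T. real (length u) \<le> B)"

lemma shallow_insertD:
  assumes "grown b n T" "v \<in> external b T" "b \<ge> 1" "shallow b B (insert v T)"
  shows "shallow b B T"
proof -
  have "real (length u) \<le> B" if "u \<in> external b T" for u
  proof (cases "u = v")
    case True
    have "v @ [0] \<in> external b (insert v T)"
      unfolding external_insert[OF assms(1,2)] using assms(3) by auto
    then show ?thesis using assms(4) True by (fastforce simp: shallow_def)
  next
    case False
    then show ?thesis
      using assms(4) that by (auto simp: shallow_def external_insert[OF assms(1,2)])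
  qed
  then show ?thesis by (simp add: shallow_def)
qed

context weighted_recursive_tree
begin

text \<open>
  Hoeffding style bound for one step: the linear term of the exponential sees only the mean increment \<open>d\<close>,
  the quadratic term only the uniform bound \<open>a\<close>.
\<close>

lemma exp_moment_step:
  fixes \<Delta> :: "node \<Rightarrow> (nat \<Rightarrow> real) \<Rightarrow> real"
  assumes meas: "\<And>v. v \<in> E \<Longrightarrow> \<Delta> v \<in> borel_measurable Q"
    and bound: "\<And>v. v \<in> E \<Longrightarrow> AE z in Q. \<bar>\<Delta> v z\<bar> \<le> a"
    and drift: "(\<Sum>v\<in>E. LINT z|Q. \<Delta> v z) \<le> real (card E) * d"
    and \<theta>: "0 \<le> \<theta>" "\<theta> * a \<le> 1"
  shows "(\<Sum>v\<in>E. \<integral>\<^sup>+z. ennreal (exp (\<theta> * \<Delta> v z)) \<partial>Q)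
    \<le> ennreal (real (card E) * exp (\<theta> * d + 2 * (\<theta> * a)\<^sup>2))"
proof -
  let ?q = "2 * (\<theta> * a)\<^sup>2"
  have each: "(\<integral>\<^sup>+z. ennreal (exp (\<theta> * \<Delta> v z)) \<partial>Q) \<le> ennreal (1 + \<theta> * (LINT z|Q. \<Delta> v z) + ?q)"
    and pos: "0 \<le> 1 + \<theta> * (LINT z|Q. \<Delta> v z) + ?q" if v: "v \<in> E" for v
  proof -
    have int: "integrable Q (\<Delta> v)"
      by (rule Q.integrable_const_bound[where B = a]) (use meas[OF v] bound[OF v] in auto)
    have small: "AE z in Q. \<bar>\<theta> * \<Delta> v z\<bar> \<le> \<theta> * a"
      using bound[OF v] by eventually_elim (use \<theta> in \<open>auto simp: abs_mult intro: mult_left_mono\<close>)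
    have ge: "AE z in Q. exp (\<theta> * \<Delta> v z) \<le> 1 + \<theta> * \<Delta> v z + ?q"
      using small
    proof eventually_elim
      case (elim z)
      have "exp (\<theta> * \<Delta> v z) \<le> 1 + \<theta> * \<Delta> v z + 2 * (\<theta> * \<Delta> v z)\<^sup>2"
        using elim \<theta> by (intro exp_le_quadratic) linarith
      moreover have "(\<theta> * \<Delta> v z)\<^sup>2 \<le> (\<theta> * a)\<^sup>2"
        using elim by (rule abs_le_square_iff[THEN iffD1, OF order_trans]) simp
      ultimately show ?case by linarith
    qed
    have nonneg: "AE z in Q. 0 \<le> 1 + \<theta> * \<Delta> v z + ?q"
      using ge by eventually_elim (rule order_trans[OF exp_ge_zero])
    have "(LINT z|Q. 1 + \<theta> * \<Delta> v z + ?q) = 1 + \<theta> * (LINT z|Q. \<Delta> v z) + ?q"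
      using int by (simp add: Q.prob_space)
    moreover have "(\<integral>\<^sup>+z. ennreal (1 + \<theta> * \<Delta> v z + ?q) \<partial>Q) = ennreal (LINT z|Q. 1 + \<theta> * \<Delta> v z + ?q)"
      using int nonneg by (intro nn_integral_eq_integral) auto
    moreover have "(\<integral>\<^sup>+z. ennreal (exp (\<theta> * \<Delta> v z)) \<partial>Q) \<le> (\<integral>\<^sup>+z. ennreal (1 + \<theta> * \<Delta> v z + ?q) \<partial>Q)"
      using ge by (intro nn_integral_mono_AE) (auto elim!: eventually_mono intro!: ennreal_leI)
    ultimately show "(\<integral>\<^sup>+z. ennreal (exp (\<theta> * \<Delta> v z)) \<partial>Q) \<le> ennreal (1 + \<theta> * (LINT z|Q. \<Delta> v z) + ?q)"
      by simp
    show "0 \<le> 1 + \<theta> * (LINT z|Q. \<Delta> v z) + ?q"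
      using integral_nonneg_AE[OF nonneg] \<open>(LINT z|Q. 1 + \<theta> * \<Delta> v z + ?q) = _\<close> by simp
  qed
  have "(\<Sum>v\<in>E. \<integral>\<^sup>+z. ennreal (exp (\<theta> * \<Delta> v z)) \<partial>Q)
      \<le> (\<Sum>v\<in>E. ennreal (1 + \<theta> * (LINT z|Q. \<Delta> v z) + ?q))"
    by (rule sum_mono) (rule each)
  also have "\<dots> = ennreal (\<Sum>v\<in>E. 1 + \<theta> * (LINT z|Q. \<Delta> v z) + ?q)"
    by (rule sum_ennreal) (rule pos)
  also have "\<dots> \<le> ennreal (real (card E) * exp (\<theta> * d + ?q))"
  proof (rule ennreal_leI)
    have "(\<Sum>v\<in>E. 1 + \<theta> * (LINT z|Q. \<Delta> v z) + ?q) =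
        real (card E) * (1 + ?q) + \<theta> * (\<Sum>v\<in>E. LINT z|Q. \<Delta> v z)"
      by (simp add: sum.distrib sum_distrib_left algebra_simps)
    also have "\<dots> \<le> real (card E) * (1 + ?q) + \<theta> * (real (card E) * d)"
      using drift \<theta> by (intro add_left_mono mult_left_mono) auto
    also have "\<dots> = real (card E) * (1 + (\<theta> * d + ?q))"
      by (simp add: algebra_simps)
    also have "\<dots> \<le> real (card E) * exp (\<theta> * d + ?q)"
      by (intro mult_left_mono exp_ge_add_one_self) auto
    finally show "(\<Sum>v\<in>E. 1 + \<theta> * (LINT z|Q. \<Delta> v z) + ?q) \<le> real (card E) * exp (\<theta> * d + ?q)" .
  qed
  finally show ?thesis .
qed

end

text \<open>
  The common features of the rescaled statistics: they start no higher than a multiple of the height plus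
  \<open>ln n\<close>, and as long as the height stays below \<open>B\<close>, a step changes them by at most \<open>O(B / n)\<close> with a mean
  of at most \<open>O(B / n\<^sup>2)\<close>.
\<close>

locale controlled_process = weighted_recursive_tree +
  fixes F :: "nat \<Rightarrow> node set \<Rightarrow> (node \<Rightarrow> nat \<Rightarrow> real) \<Rightarrow> real" and c :: real
  assumes c: "c \<ge> 1"
    and F_measurable: "\<And>n T. F n T \<in> borel_measurable \<W>"
    and F_start: "\<And>n T w. grown b n T \<Longrightarrow> admissible b C w \<Longrightarrow>
      \<exists>v\<in>external b T. F n T w \<le> c * (1 + ln n + length v)"
    and F_increment: "\<And>n T w B v z. grown b n T \<Longrightarrow> admissible b C w \<Longrightarrow> 1 \<le> B \<Longrightarrow> shallow b B T \<Longrightarrow>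
      v \<in> external b T \<Longrightarrow> \<forall>i<b. 0 \<le> z i \<and> z i \<le> C \<Longrightarrow>
      \<bar>F (Suc n) (insert v T) (w(v := z)) - F n T w\<bar> \<le> c * B / n"
    and F_drift: "\<And>n T w B. grown b n T \<Longrightarrow> admissible b C w \<Longrightarrow> 1 \<le> B \<Longrightarrow> shallow b B T \<Longrightarrow>
      (\<Sum>v\<in>external b T. LINT z|Q. F (Suc n) (insert v T) (w(v := z)) - F n T w)
        \<le> leaves b n * (c * B / (real n)\<^sup>2)"
begin

text \<open>
  Up to time \<open>M\<close> the process is dominated by multiples of the height and of \<open>ln M\<close>; the exponential moment of the height is bounded by that of the profile.
  From then on each step costs a factor \<open>exp (a / n\<^sup>2)\<close>, with \<open>a\<close> the constant multiplying \<open>2 / M - 2 / n\<close>.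
  Trees that are too high are cut off inside the expectation; as the height never decreases, this
  keeps the recursion closed. The term \<open>2 / M - 2 / n\<close> is a telescoping bound for the sum of \<open>1 / k\<^sup>2\<close>.
\<close>

lemma moment_bound:
  fixes M n :: nat
  assumes \<theta>: "0 \<le> \<theta>" and B: "1 \<le> B" and \<theta>B: "\<theta> * c * B \<le> M" and M: "1 \<le> M" "M \<le> n"
  shows "expect n (\<lambda>T w. ennreal (if shallow b B T then exp (\<theta> * F n T w) else 0))
    \<le> ennreal (exp ((\<theta> * c + 2 * b * exp (\<theta> * c)) * (1 + ln M)
        + (\<theta> * c * B + 2 * (\<theta> * c * B)\<^sup>2) * (2 / M - 2 / n)))"
  using M(2)
proof (induction n rule: dec_induct)
  case base
  have "expect M (\<lambda>T w. ennreal (if shallow b B T then exp (\<theta> * F M T w) else 0))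
      \<le> expect M (\<lambda>T w. ennreal (exp (\<theta> * c * (1 + ln M)))
          * ennreal (\<Sum>v\<in>external b T. exp (\<theta> * c * length v)))"
  proof (rule expect_mono[OF _ M(1)])
    fix T w assume T: "grown b M T" and w: "admissible b C w"
    obtain v where v: "v \<in> external b T" "F M T w \<le> c * (1 + ln M + length v)"
      using F_start[OF T w] by blast
    have "\<theta> * F M T w \<le> \<theta> * c * (1 + ln M) + \<theta> * c * length v"
      using mult_left_mono[OF v(2) \<theta>] by (simp add: algebra_simps)
    then have "exp (\<theta> * F M T w) \<le> exp (\<theta> * c * (1 + ln M)) * exp (\<theta> * c * length v)"
      by (simp flip: exp_add)
    also have "\<dots> \<le> exp (\<theta> * c * (1 + ln M)) * (\<Sum>v\<in>external b T. exp (\<theta> * c * length v))"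
      using v(1) external_finite[OF grown_finite[OF T], of b]
      by (intro mult_left_mono member_le_sum[where f = "\<lambda>v. exp (\<theta> * c * length v)"]) auto
    finally show "ennreal (if shallow b B T then exp (\<theta> * F M T w) else 0)
        \<le> ennreal (exp (\<theta> * c * (1 + ln M))) * ennreal (\<Sum>v\<in>external b T. exp (\<theta> * c * length v))"
      by (subst ennreal_mult[symmetric]) (auto intro!: sum_nonneg ennreal_leI)
  qed
  also have "\<dots> = ennreal (exp (\<theta> * c * (1 + ln M)))
      * expect M (\<lambda>T w. ennreal (\<Sum>v\<in>external b T. exp (\<theta> * c * length v)))"
    by (rule expect_cmult) simp
  also have "\<dots> \<le> ennreal (exp (\<theta> * c * (1 + ln M))) * ennreal (exp (2 * b * exp (\<theta> * c) * (1 + ln M)))"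
    by (intro mult_left_mono profile_moment M) simp
  also have "\<dots> = ennreal (exp ((\<theta> * c + 2 * b * exp (\<theta> * c)) * (1 + ln M)))"
    by (subst ennreal_mult[symmetric]) (auto simp: distrib_right simp flip: exp_add)
  finally show ?case by simp
next
  case (step n)
  let ?a = "\<theta> * c * B + 2 * (\<theta> * c * B)\<^sup>2"
  let ?f = "\<lambda>n T w. ennreal (if shallow b B T then exp (\<theta> * F n T w) else 0)"
  have n: "n \<ge> 1" "M \<le> n" using step M by auto
  have a: "0 \<le> ?a" using \<theta> c B by simp
  have "expect (Suc n) (?f (Suc n)) \<le> expect n (\<lambda>T w. ennreal (exp (?a / (real n)\<^sup>2)) * ?f n T w)"
  proof (rule expect_Suc_le[OF _ n(1)])
    show "?f (Suc n) T \<in> borel_measurable \<W>" for T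
      using F_measurable[of "Suc n" T] by (cases "shallow b B T") simp_all
    fix T w assume T: "grown b n T" and w: "admissible b C w" and ws: "w \<in> space \<W>"
    let ?E = "external b T"
    show "(\<Sum>v\<in>?E. \<integral>\<^sup>+z. ?f (Suc n) (insert v T) (w(v := z)) \<partial>Q)
        \<le> ennreal (leaves b n) * (ennreal (exp (?a / (real n)\<^sup>2)) * ?f n T w)"
    proof (cases "shallow b B T")
      case False
      then have "\<not> shallow b B (insert v T)" if "v \<in> ?E" for v
        using shallow_insertD[OF T that] b by auto
      then show ?thesis by simp
    next
      case shallow: True
      define \<Delta> where "\<Delta> v z = F (Suc n) (insert v T) (w(v := z)) - F n T w" for v z
      have meas: "\<Delta> v \<in> borel_measurable Q" if "v \<in> ?E" for v
      proof -
        have v: "v \<in> nodes b" using external_nodes[OF T] that by blast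
        have "(\<lambda>z. w(v := z)) \<in> Q \<rightarrow>\<^sub>M \<W>"
          using measurable_compose[OF measurable_Pair1'[OF ws] update_measurable[OF v]] by simp
        then show ?thesis
          unfolding \<Delta>_def using F_measurable by (intro borel_measurable_diff) auto
      qed
      have "(\<Sum>v\<in>?E. \<integral>\<^sup>+z. ennreal (exp (\<theta> * \<Delta> v z)) \<partial>Q)
          \<le> ennreal (real (card ?E) * exp (\<theta> * (c * B / (real n)\<^sup>2) + 2 * (\<theta> * (c * B / n))\<^sup>2))"
      proof (rule exp_moment_step[OF meas])
        show "AE z in Q. \<bar>\<Delta> v z\<bar> \<le> c * B / n" if "v \<in> ?E" for v
          using Q_bounds unfolding \<Delta>_def
          by eventually_elim (rule F_increment[OF T w B shallow that])
        show "(\<Sum>v\<in>?E. LINT z|Q. \<Delta> v z) \<le> real (card ?E) * (c * B / (real n)\<^sup>2)"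
          using F_drift[OF T w B shallow] card_external[OF T] unfolding \<Delta>_def by simp
        have "\<theta> * c * B \<le> real n" using \<theta>B n(2) by linarith
        then show "\<theta> * (c * B / n) \<le> 1" using n(1) by (simp add: field_simps)
      qed (use \<theta> in auto)
      moreover have "\<theta> * (c * B / (real n)\<^sup>2) + 2 * (\<theta> * (c * B / n))\<^sup>2 = ?a / (real n)\<^sup>2"
        unfolding add_divide_distrib by (simp add: power_mult_distrib power_divide)
      ultimately have step_le: "(\<Sum>v\<in>?E. \<integral>\<^sup>+z. ennreal (exp (\<theta> * \<Delta> v z)) \<partial>Q)
          \<le> ennreal (leaves b n * exp (?a / (real n)\<^sup>2))"
        by (simp only: card_external[OF T])
      have "(\<Sum>v\<in>?E. \<integral>\<^sup>+z. ?f (Suc n) (insert v T) (w(v := z)) \<partial>Q)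
          \<le> (\<Sum>v\<in>?E. \<integral>\<^sup>+z. ennreal (exp (\<theta> * F n T w)) * ennreal (exp (\<theta> * \<Delta> v z)) \<partial>Q)"
        unfolding \<Delta>_def
        by (intro sum_mono nn_integral_mono, subst ennreal_mult[symmetric])
          (auto intro!: ennreal_leI simp: right_diff_distrib simp flip: exp_add)
      also have "(\<Sum>v\<in>?E. \<integral>\<^sup>+z. ennreal (exp (\<theta> * F n T w)) * ennreal (exp (\<theta> * \<Delta> v z)) \<partial>Q)
          = ennreal (exp (\<theta> * F n T w)) * (\<Sum>v\<in>?E. \<integral>\<^sup>+z. ennreal (exp (\<theta> * \<Delta> v z)) \<partial>Q)"
        unfolding sum_distrib_left by (intro sum.cong refl nn_integral_cmult) (use meas in auto)
      also have "\<dots> \<le> ennreal (exp (\<theta> * F n T w)) * ennreal (leaves b n * exp (?a / (real n)\<^sup>2))"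
        by (intro mult_left_mono step_le) simp
      also have "\<dots> = ennreal (leaves b n) * (ennreal (exp (?a / (real n)\<^sup>2)) * ?f n T w)"
        using shallow leaves_pos[of n] by (simp add: ennreal_mult' ac_simps)
      finally show ?thesis .
    qed
  qed
  also have "\<dots> = ennreal (exp (?a / (real n)\<^sup>2)) * expect n (?f n)"
  proof (rule expect_cmult)
    show "?f n T \<in> borel_measurable \<W>" for T
      using F_measurable[of n T] by (cases "shallow b B T") simp_all
  qed
  also have "\<dots> \<le> ennreal (exp (?a / (real n)\<^sup>2)) *
      ennreal (exp ((\<theta> * c + 2 * b * exp (\<theta> * c)) * (1 + ln M) + ?a * (2 / M - 2 / n)))"
    by (intro mult_left_mono step.IH) simp
  also have "\<dots> = ennreal (exp ((\<theta> * c + 2 * b * exp (\<theta> * c)) * (1 + ln M)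
      + ?a * (1 / (real n)\<^sup>2 + 2 / M - 2 / n)))"
  proof -
    have "a / q + (R + a * (x - y)) = R + a * (1 / q + x - y)" for a q R x y :: real
      by (simp add: algebra_simps)
    then show ?thesis
      by (subst ennreal_mult[symmetric]) (auto simp flip: exp_add)
  qed
  also have "\<dots> \<le> ennreal (exp ((\<theta> * c + 2 * b * exp (\<theta> * c)) * (1 + ln M)
      + ?a * (2 / M - 2 / Suc n)))"
  proof -
    have "1 / (real n)\<^sup>2 = 2 / (real n * (2 * n))"
      by (simp add: power2_eq_square)
    also have "\<dots> \<le> 2 / (real n * Suc n)"
      using n(1) by (intro divide_left_mono mult_left_mono mult_pos_pos) auto
    also have "\<dots> = 2 / n - 2 / Suc n"
      using n(1) by (simp add: field_simps)
    finally have "1 / (real n)\<^sup>2 \<le> 2 / n - 2 / Suc n" .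
    then have "?a * (1 / (real n)\<^sup>2 + 2 / M - 2 / n) \<le> ?a * (2 / M - 2 / Suc n)"
      by (intro mult_left_mono a) linarith
    then show ?thesis by (intro ennreal_leI) simp
  qed
  finally show ?case .
qed

text \<open>
  Markov's inequality for the truncated exponential, plus the probability that the height exceeds \<open>B\<close>.
\<close>

lemma tail_bound:
  fixes M n :: nat
  assumes \<theta>: "0 \<le> \<theta>" and B: "1 \<le> B" and \<theta>B: "\<theta> * c * B \<le> M" and M: "1 \<le> M" "M \<le> n"
  shows "expect n (\<lambda>T w. indicator {w. F n T w > x} w)
    \<le> ennreal (exp ((\<theta> * c + 2 * b * exp (\<theta> * c)) * (1 + ln M)
        + (\<theta> * c * B + 2 * (\<theta> * c * B)\<^sup>2) * (2 / M) - \<theta> * x)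
      + exp (2 * b * exp 1 * (1 + ln n) - B))"
proof -
  let ?R = "(\<theta> * c + 2 * b * exp (\<theta> * c)) * (1 + ln M)"
  let ?a = "\<theta> * c * B + 2 * (\<theta> * c * B)\<^sup>2"
  let ?f = "\<lambda>T w. ennreal (if shallow b B T then exp (\<theta> * F n T w) else 0)"
  let ?g = "\<lambda>T (w :: node \<Rightarrow> nat \<Rightarrow> real). ennreal (\<Sum>v\<in>external b T. exp (1 * length v))"
  have n: "n \<ge> 1" using M by simp
  have "expect n (\<lambda>T w. indicator {w. F n T w > x} w)
      \<le> expect n (\<lambda>T w. ennreal (exp (- \<theta> * x)) * ?f T w + ennreal (exp (- B)) * ?g T w)"
  proof (rule expect_mono[OF _ n])
    fix T w assume T: "grown b n T"
    show "(indicator {w. F n T w > x} w :: ennreal)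
        \<le> ennreal (exp (- \<theta> * x)) * ?f T w + ennreal (exp (- B)) * ?g T w"
    proof (cases "F n T w > x")
      case gt: True
      show ?thesis
      proof (cases "shallow b B T")
        case True
        have "\<theta> * x \<le> \<theta> * F n T w" using gt \<theta> by (intro mult_left_mono) auto
        then have "1 \<le> ennreal (exp (- \<theta> * x)) * ?f T w"
          using True by (auto simp flip: ennreal_mult exp_add)
        then show ?thesis
          using gt by (auto intro: add_increasing2)
      next
        case False
        then obtain u where u: "u \<in> external b T" "B < length u"
          by (auto simp: shallow_def not_le)
        have "exp (real (length u)) \<le> (\<Sum>v\<in>external b T. exp (real (length v)))"
          using u(1) external_finite[OF grown_finite[OF T], of b]
          by (intro member_le_sum[where f = "\<lambda>v. exp (real (length v))"]) auto
        moreover have "1 \<le> exp (- B) * exp (real (length u))"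
          using u(2) by (simp flip: exp_add)
        ultimately have "1 \<le> exp (- B) * (\<Sum>v\<in>external b T. exp (real (length v)))"
          by (meson exp_ge_zero mult_left_mono order_trans)
        then have "1 \<le> ennreal (exp (- B)) * ?g T w"
          by (simp add: sum_nonneg flip: ennreal_mult)
        then show ?thesis
          using gt by (auto intro: add_increasing)
      qed
    qed simp
  qed
  also have "\<dots> = ennreal (exp (- \<theta> * x)) * expect n ?f + ennreal (exp (- B)) * expect n ?g"
  proof -
    have f: "?f T \<in> borel_measurable \<W>" for T
      using F_measurable[of n T] by (cases "shallow b B T") simp_all
    have "expect n (\<lambda>T w. ennreal (exp (- \<theta> * x)) * ?f T w + ennreal (exp (- B)) * ?g T w) =
        expect n (\<lambda>T w. ennreal (exp (- \<theta> * x)) * ?f T w) + expect n (\<lambda>T w. ennreal (exp (- B)) * ?g T w)"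
      unfolding expect_def using f
      by (subst nn_integral_add[symmetric], simp, simp, subst nn_integral_add) auto
    then show ?thesis using f by (simp only: expect_cmult borel_measurable_const)
  qed
  also have "\<dots> \<le> ennreal (exp (- \<theta> * x)) * ennreal (exp (?R + ?a * (2 / M - 2 / n)))
      + ennreal (exp (- B)) * ennreal (exp (2 * b * exp 1 * (1 + ln n)))"
    by (intro add_mono mult_left_mono moment_bound assms) (use profile_moment[OF n, of 1] in auto)
  also have "\<dots> = ennreal (exp (?R + ?a * (2 / M - 2 / n) - \<theta> * x) + exp (2 * b * exp 1 * (1 + ln n) - B))"
    by (simp add: algebra_simps exp_diff exp_add exp_minus flip: ennreal_mult ennreal_plus)
       (simp add: field_simps)
  also have "\<dots> \<le> ennreal (exp (?R + ?a * (2 / M) - \<theta> * x) + exp (2 * b * exp 1 * (1 + ln n) - B))"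
  proof -
    have "?a * (2 / M - 2 / n) \<le> ?a * (2 / M)"
      using \<theta> c B by (intro mult_left_mono) auto
    then show ?thesis by (intro ennreal_leI) simp
  qed
  finally show ?thesis .
qed


text \<open>
  A start at time \<open>M\<close> of order \<open>(ln n) ^ 3\<close> keeps the sum of the squares of the later increments at \<open>o(1)\<close>,
  even after multiplication by \<open>\<theta>\<^sup>2\<close> and although \<open>B\<close> grows with \<open>n\<close>. Since \<open>ln M\<close> is only of order \<open>ln (ln n)\<close>, the exponent \<open>\<theta>\<close> may be a
  multiple of \<open>ln (ln n)\<close>: the moment of the profile at time \<open>M\<close> then contributes
  \<open>O(sqrt (ln n) * ln (ln n))\<close> to the exponent, far less than the gain \<open>\<theta> * s * ln n\<close>. This is what produces
  the factor \<open>ln (ln n)\<close> in the rate.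
\<close>

lemma tail_asymptotic:
  assumes s: "s > 0"
  shows "\<forall>\<^sub>F n in sequentially. expect n (\<lambda>T w. indicator {w. F n T w > s * ln n} w)
    \<le> ennreal (exp (- (s / (4 * c)) * ln n * ln (ln n)))"
proof -
  define k where "k = s / (4 * c)"
  have k: "k > 0" and sk: "s = 4 * c * k"
    using s c by (auto simp: k_def)
  define \<beta> where "\<beta> = 2 * real b"
  have "\<forall>\<^sub>F n :: nat in sequentially. 0 \<le> ln (ln n)" by real_asymp
  moreover have "\<forall>\<^sub>F n :: nat in sequentially. 1 \<le> ln n * (ln (ln n))\<^sup>2" by real_asymp
  moreover have "\<forall>\<^sub>F n :: nat in sequentially. ln (ln n) / 2 * (ln n * (ln (ln n))\<^sup>2) \<le> ln n ^ 3"
    by real_asymp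
  moreover have "\<forall>\<^sub>F n :: nat in sequentially. 1 \<le> ln n ^ 3" by real_asymp
  moreover have "\<forall>\<^sub>F n :: nat in sequentially. ln n ^ 3 + 1 \<le> n" by real_asymp
  moreover have "\<forall>\<^sub>F n :: nat in sequentially. ln (ln n ^ 3 + 1) \<le> 4 * ln (ln n)" by real_asymp
  moreover have "\<forall>\<^sub>F n :: nat in sequentially.
      (ln (ln n) / 2 + \<beta> * exp (ln (ln n) / 2)) * (1 + 4 * ln (ln n))
      + (ln (ln n) / 2 * (ln n * (ln (ln n))\<^sup>2) + 2 * (ln (ln n) / 2 * (ln n * (ln (ln n))\<^sup>2))\<^sup>2) * (2 / ln n ^ 3)
      + ln 2 \<le> k * ln n * ln (ln n)"
    using k by real_asymp
  moreover have "\<forall>\<^sub>F n :: nat in sequentially.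
      \<beta> * exp 1 * (1 + ln n) + k * ln n * ln (ln n) + ln 2 \<le> ln n * (ln (ln n))\<^sup>2"
    using k by real_asymp
  ultimately show ?thesis
  proof eventually_elim
    case (elim n)
    let ?L = "ln (real n)" and ?LL = "ln (ln (real n))"
    \<comment> \<open>The upper bound for \<open>M\<close> matters for the start, the lower one for the increments after it.\<close>
    define M where "M = nat \<lceil>?L ^ 3\<rceil>"
    have M: "?L ^ 3 \<le> M" "M \<le> ?L ^ 3 + 1" "1 \<le> real M"
      using elim(4) unfolding M_def by linarith+
    have Mn: "1 \<le> M" "M \<le> n"
      using M elim(5) by linarith+
    define \<theta> where "\<theta> = ?LL / (2 * c)"
    define B where "B = ?L * ?LL\<^sup>2"
    have \<theta>: "0 \<le> \<theta>" "\<theta> * c = ?LL / 2"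
      using elim(1) c by (auto simp: \<theta>_def)
    let ?a = "\<theta> * c * B + 2 * (\<theta> * c * B)\<^sup>2"
    have "0 \<le> B" using elim(2) by (simp add: B_def)
    have "ln M \<le> ln (?L ^ 3 + 1)"
      using M by simp
    then have lnM: "ln M \<le> 4 * ?LL"
      using elim(6) by linarith
    have "(\<theta> * c + 2 * b * exp (\<theta> * c)) * (1 + ln M) \<le> (?LL / 2 + \<beta> * exp (?LL / 2)) * (1 + 4 * ?LL)"
      unfolding \<theta>(2) \<beta>_def using lnM elim(1) by (auto intro!: mult_left_mono)
    moreover have inv: "2 / real M \<le> 2 / ?L ^ 3"
    proof (rule divide_left_mono[OF M(1)])
      show "0 < real M * ?L ^ 3" using M elim(4) by (intro mult_pos_pos) linarith+
    qed simp
    moreover have "?a * (2 / M) \<le> ?a * (2 / ?L ^ 3)"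
      using inv \<theta> c \<open>0 \<le> B\<close> by (intro mult_left_mono) auto
    moreover have "\<theta> * (s * ?L) = 2 * (k * ?L * ?LL)"
      using c by (simp add: \<theta>_def sk)
    ultimately have 1: "(\<theta> * c + 2 * b * exp (\<theta> * c)) * (1 + ln M) + ?a * (2 / M) - \<theta> * (s * ?L)
        \<le> - (k * ?L * ?LL) - ln 2"
      using elim(7) unfolding \<theta>(2) B_def by linarith
    have 2: "2 * b * exp 1 * (1 + ?L) - B \<le> - (k * ?L * ?LL) - ln 2"
      using elim(8) unfolding B_def \<beta>_def by linarith
    have "expect n (\<lambda>T w. indicator {w. F n T w > s * ?L} w)
        \<le> ennreal (exp ((\<theta> * c + 2 * b * exp (\<theta> * c)) * (1 + ln M) + ?a * (2 / M) - \<theta> * (s * ?L))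
          + exp (2 * b * exp 1 * (1 + ?L) - B))"
    proof (rule tail_bound[OF \<theta>(1) _ _ Mn])
      show "1 \<le> B" using elim(2) by (simp add: B_def)
      show "\<theta> * c * B \<le> M" using elim(3) M(1) unfolding \<theta>(2) B_def by linarith
    qed
    also have "\<dots> \<le> ennreal (exp (- (k * ?L * ?LL) - ln 2) + exp (- (k * ?L * ?LL) - ln 2))"
      using 1 2 by (intro ennreal_leI add_mono) auto
    also have "exp (- (k * ?L * ?LL) - ln 2) + exp (- (k * ?L * ?LL) - ln 2) = exp (- k * ?L * ?LL)"
      by (simp add: exp_diff)
    finally show ?case unfolding k_def .
  qed
qed

end

section \<open>The two controlled processes\<close>

lemma external_deepest:
  assumes "grown b n T" "b \<ge> 1"
  obtains v where "v \<in> external b T" "shallow b (length v) T"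
proof -
  have fin: "finite (external b T)" and ne: "external b T \<noteq> {}"
    using external_finite[OF grown_finite[OF assms(1)]] external_nonempty[OF assms] by auto
  obtain v where v: "v \<in> external b T" "length v = Max (length ` external b T)"
    using Max_in[of "length ` external b T"] fin ne by fastforce
  have "length u \<le> length v" if "u \<in> external b T" for u
    using v(2) fin that by simp
  then show ?thesis using that v(1) by (simp add: shallow_def)
qed

context weighted_recursive_tree
begin

text \<open>
  Chosen large enough to serve all the controlled processes at once; it also equals four times the factor that
  relates \<open>mean_overlap\<close> to the correction term of the Wiener index on the scale \<open>n\<^sup>2\<close>.
\<close>

definition increment_bound :: real where
  "increment_bound = 4 * (real b)\<^sup>2 * C"

text \<open>
  The mean of the average external depth: a new leaf raises it by \<open>b * \<mu> / leaves b (n + 1)\<close> on average.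
\<close>

definition drift :: "nat \<Rightarrow> real" where
  "drift n = b * \<mu> * (\<Sum>k=1..n. 1 / leaves b k)"

definition fluctuation :: "nat \<Rightarrow> node set \<Rightarrow> (node \<Rightarrow> nat \<Rightarrow> real) \<Rightarrow> real" where
  "fluctuation n T w = external_path b T w / leaves b n - drift n"

definition mean_overlap :: "nat \<Rightarrow> node set \<Rightarrow> real" where
  "mean_overlap n T = overlaps (external b T) / (leaves b n)\<^sup>2"

lemma increment_bound_ge: "increment_bound \<ge> 2 * b * C" "increment_bound \<ge> 4 * (real b)\<^sup>2" "increment_bound \<ge> C" "increment_bound \<ge> 1"
proof -
  have b1: "1 * real b \<le> real b * real b" using b by (intro mult_right_mono) auto
  have 1: "2 * real b \<le> 4 * (real b)\<^sup>2" and 2: "1 \<le> 4 * (real b)\<^sup>2"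
    using b1 b unfolding power2_eq_square by linarith+
  show "increment_bound \<ge> 2 * b * C"
    unfolding increment_bound_def using 1 C by (intro mult_right_mono) auto
  have "4 * (real b)\<^sup>2 * 1 \<le> increment_bound"
    unfolding increment_bound_def using C by (intro mult_left_mono) auto
  then show "increment_bound \<ge> 4 * (real b)\<^sup>2" "increment_bound \<ge> 1" using 2 by linarith+
  have "1 * C \<le> increment_bound"
    unfolding increment_bound_def using C 2 by (intro mult_right_mono) auto
  then show "increment_bound \<ge> C" by simp
qed

lemma drift_Suc: "drift (Suc n) = drift n + b * \<mu> / leaves b (Suc n)"
  by (simp add: drift_def algebra_simps)

lemma drift_nonneg: "0 \<le> drift n"
  unfolding drift_def using mu_pos leaves_pos by (intro mult_nonneg_nonneg sum_nonneg) (auto simp: less_imp_le)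

lemma drift_le: "n \<ge> 1 \<Longrightarrow> drift n \<le> b * C * (1 + ln n)"
proof -
  assume n: "n \<ge> 1"
  have "(\<Sum>k=1..n. 1 / leaves b k) \<le> (\<Sum>k=1..n. 1 / k)"
  proof (rule sum_mono)
    fix k assume "k \<in> {1..n}"
    then show "1 / leaves b k \<le> 1 / k"
      using leaves_ge[OF b, of k] leaves_pos[of k] by (intro divide_left_mono mult_pos_pos) auto
  qed
  also have "\<dots> = harm n"
    by (simp add: harm_def inverse_eq_divide)
  also have "\<dots> \<le> 1 + ln n"
    using euler_mascheroni_sequence_decreasing[of 1 n] n by (simp add: harm_expand)
  finally have h: "(\<Sum>k=1..n. 1 / leaves b k) \<le> 1 + ln n" .
  have "b * \<mu> * (\<Sum>k=1..n. 1 / leaves b k) \<le> b * \<mu> * (1 + ln n)"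
    using h mu_pos by (intro mult_left_mono) auto
  also have "\<dots> \<le> b * C * (1 + ln n)"
    using mu_le n by (intro mult_right_mono mult_left_mono) auto
  finally show "drift n \<le> b * C * (1 + ln n)" by (simp add: drift_def)
qed

text \<open>
  Only the difference between the depth of the chosen node and the average depth survives. Its mean over the
  external nodes is zero, and so is the mean of the weight term: \<open>fluctuation\<close> is a martingale.
\<close>

lemma fluctuation_insert:
  assumes "grown b n T" "v \<in> external b T"
  shows "fluctuation (Suc n) (insert v T) (w(v := z)) - fluctuation n T w =
    ((real b - 1) * (depth w v - external_path b T w / leaves b n) + ((\<Sum>i<b. z i) - b * \<mu>))
      / leaves b (Suc n)"
proof -
  have alg: "(X + d * D + S) / m' - (h + p / m') - (X / m - h) = (d * (D - X / m) + (S - p)) / m'"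
    if "0 < m" "0 < m'" "m' = m + d" for X d D S m m' h p :: real
  proof -
    define k where "k = X / m"
    have "X = k * (m' - d)" using that by (simp add: k_def)
    moreover have "(k * (m' - d) + d * D + S) / m' - (h + p / m') - (k - h) = (d * (D - k) + (S - p)) / m'"
      using that(2) by (simp add: field_simps)
    ultimately show ?thesis by (simp add: k_def)
  qed
  show ?thesis
    unfolding fluctuation_def drift_Suc external_path_insert[OF assms]
    by (rule alg) (use leaves_pos[of n] leaves_pos[of "Suc n"] in \<open>simp_all add: leaves_Suc\<close>)
qed

lemma mean_path_bounds:
  assumes T: "grown b n T" and w: "admissible b C w" and B: "shallow b B T"
  shows "0 \<le> external_path b T w / leaves b n" "external_path b T w / leaves b n \<le> C * B"
    "v \<in> external b T \<Longrightarrow> 0 \<le> depth w v" "v \<in> external b T \<Longrightarrow> depth w v \<le> C * B"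
proof -
  have "0 \<le> external_path b T w" "external_path b T w \<le> leaves b n * (C * B)"
    using external_path_bounds[OF T w, of B] B C by (auto simp: shallow_def)
  then show "0 \<le> external_path b T w / leaves b n" "external_path b T w / leaves b n \<le> C * B"
    using leaves_pos[of n] by (auto simp: field_simps)
  show "0 \<le> depth w v" "depth w v \<le> C * B" if v: "v \<in> external b T"
  proof -
    have "C * length v \<le> C * B"
      using B C v by (intro mult_left_mono) (auto simp: shallow_def)
    then show "0 \<le> depth w v" "depth w v \<le> C * B"
      using depth_bounds[OF w, of v] external_nodes[OF T] v by fastforce+
  qed
qed

lemma fluctuation_controlled:
  assumes \<sigma>: "\<sigma> = 1 \<or> \<sigma> = - 1"
  shows "controlled_process b Q C \<mu> (\<lambda>n T w. \<sigma> * fluctuation n T w) increment_bound"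
proof unfold_locales
  show "1 \<le> increment_bound" by (rule increment_bound_ge)
  show "(\<lambda>w. \<sigma> * fluctuation n T w) \<in> borel_measurable \<W>" for n T
    unfolding fluctuation_def external_path_def by measurable
next
  fix n T w assume T: "grown b n T" and w: "admissible b C w"
  have n: "n \<ge> 1" by (rule grown_pos[OF T])
  then have ln0: "0 \<le> ln n" by simp
  obtain v where v: "v \<in> external b T" "shallow b (length v) T"
    using external_deepest[OF T] b by auto
  have "\<sigma> * fluctuation n T w \<le> C * length v + b * C * (1 + ln n)"
    using \<sigma> mean_path_bounds(1,2)[OF T w v(2)] drift_nonneg[of n] drift_le[OF n] C
    unfolding fluctuation_def by auto
  also have "\<dots> \<le> increment_bound * length v + increment_bound * (1 + ln n)"
    using increment_bound_ge C ln0 by (intro add_mono mult_right_mono) auto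
  finally show "\<exists>v\<in>external b T. \<sigma> * fluctuation n T w \<le> increment_bound * (1 + ln n + length v)"
    using v(1) by (auto simp: algebra_simps)
next
  fix n T w B v and z :: "nat \<Rightarrow> real"
  assume T: "grown b n T" and w: "admissible b C w" and B: "1 \<le> B" "shallow b B T"
    and v: "v \<in> external b T" and z: "\<forall>i<b. 0 \<le> z i \<and> z i \<le> C"
  have n: "n \<ge> 1" by (rule grown_pos[OF T])
  let ?x = "depth w v - external_path b T w / leaves b n"
  let ?y = "(\<Sum>i<b. z i) - b * \<mu>"
  have x: "\<bar>?x\<bar> \<le> C * B"
    using mean_path_bounds(1,2)[OF T w B(2)] mean_path_bounds(3,4)[OF T w B(2) v] by linarith
  have "0 \<le> (\<Sum>i<b. z i)" "(\<Sum>i<b. z i) \<le> b * C"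
    using z sum_bounded_above[of "{..<b}" z C] by (auto intro!: sum_nonneg)
  moreover have "0 \<le> b * \<mu>" "b * \<mu> \<le> b * C"
    using mu_pos mu_le by (auto intro: mult_left_mono)
  ultimately have y: "\<bar>?y\<bar> \<le> b * C" by linarith
  have "\<bar>\<sigma> * fluctuation (Suc n) (insert v T) (w(v := z)) - \<sigma> * fluctuation n T w\<bar> =
      \<bar>fluctuation (Suc n) (insert v T) (w(v := z)) - fluctuation n T w\<bar>"
    using \<sigma> by auto
  also have "\<dots> = \<bar>(real b - 1) * ?x + ?y\<bar> / leaves b (Suc n)"
    unfolding fluctuation_insert[OF T v] using leaves_pos[of "Suc n"] by simp
  also have "\<dots> \<le> increment_bound * B / leaves b (Suc n)"
  proof (rule divide_right_mono)
    have "\<bar>(real b - 1) * ?x + ?y\<bar> \<le> (real b - 1) * \<bar>?x\<bar> + \<bar>?y\<bar>"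
      using b abs_triangle_ineq[of "(real b - 1) * ?x" ?y] by (simp add: abs_mult)
    also have "\<dots> \<le> real b * (C * B) + b * C * B"
    proof (rule add_mono)
      show "(real b - 1) * \<bar>?x\<bar> \<le> real b * (C * B)"
        using x by (intro mult_mono) auto
      have "b * C * 1 \<le> b * C * B"
        using B(1) C by (intro mult_left_mono) auto
      then show "\<bar>?y\<bar> \<le> b * C * B" using y by linarith
    qed
    also have "\<dots> \<le> increment_bound * B"
      using mult_right_mono[OF increment_bound_ge(1), of B] B(1) by (simp add: algebra_simps)
    finally show "\<bar>(real b - 1) * ?x + ?y\<bar> \<le> increment_bound * B" .
  qed (use leaves_pos in \<open>simp add: less_imp_le\<close>)
  also have "\<dots> \<le> increment_bound * B / n"
    using leaves_ge[OF b, of "Suc n"] leaves_pos[of "Suc n"] n increment_bound_ge(4) B(1)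
    by (intro divide_left_mono mult_pos_pos mult_nonneg_nonneg) auto
  finally show "\<bar>\<sigma> * fluctuation (Suc n) (insert v T) (w(v := z)) - \<sigma> * fluctuation n T w\<bar>
      \<le> increment_bound * B / n" .
next
  fix n T w and B :: real assume T: "grown b n T" and B: "1 \<le> B"
  let ?E = "external b T"
  have int: "integrable Q (\<lambda>z. \<Sum>i<b. z i)"
    by (intro Bochner_Integration.integrable_sum component_integrable) simp
  have zero: "(LINT z|Q. (\<Sum>i<b. z i) - b * \<mu>) = 0"
    using int component_integrable mean by (simp add: Bochner_Integration.integral_sum Q.prob_space)
  have each: "(LINT z|Q. \<sigma> * fluctuation (Suc n) (insert v T) (w(v := z)) - \<sigma> * fluctuation n T w) =
      \<sigma> * ((real b - 1) * (depth w v - external_path b T w / leaves b n)) / leaves b (Suc n)"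
    if v: "v \<in> ?E" for v
  proof -
    have "\<sigma> * fluctuation (Suc n) (insert v T) (w(v := z)) - \<sigma> * fluctuation n T w =
        \<sigma> / leaves b (Suc n) * ((real b - 1) * (depth w v - external_path b T w / leaves b n))
        + \<sigma> / leaves b (Suc n) * ((\<Sum>i<b. z i) - b * \<mu>)" for z
      unfolding right_diff_distrib[symmetric] fluctuation_insert[OF T v]
      by (simp add: add_divide_distrib distrib_left)
    then show ?thesis
      using int zero by (simp add: Q.prob_space)
  qed
  have "(\<Sum>v\<in>?E. depth w v - external_path b T w / leaves b n) = 0"
    using card_external[OF T] leaves_pos[of n] by (simp add: sum_subtractf external_path_def)
  then have "(\<Sum>v\<in>?E. LINT z|Q. \<sigma> * fluctuation (Suc n) (insert v T) (w(v := z)) - \<sigma> * fluctuation n T w) = 0"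
    by (simp add: each flip: sum_distrib_left sum_divide_distrib)
  also have "0 \<le> leaves b n * (increment_bound * B / (real n)\<^sup>2)"
    using leaves_pos[of n] increment_bound_ge(4) B by simp
  finally show "(\<Sum>v\<in>?E. LINT z|Q. \<sigma> * fluctuation (Suc n) (insert v T) (w(v := z)) - \<sigma> * fluctuation n T w)
      \<le> leaves b n * (increment_bound * B / (real n)\<^sup>2)" .
qed

lemma overlaps_bounds:
  assumes T: "grown b n T" and B: "shallow b B T"
  shows "0 \<le> overlaps (external b T)" "overlaps (external b T) \<le> (leaves b n)\<^sup>2 * B"
    "0 \<le> (\<Sum>y\<in>external b T. overlap v y)"
    "v \<in> external b T \<Longrightarrow> (\<Sum>y\<in>external b T. overlap v y) \<le> leaves b n * B"
proof -
  let ?E = "external b T"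
  show nonneg: "0 \<le> (\<Sum>y\<in>?E. overlap v y)" for v
    by (intro sum_nonneg) simp
  show le: "(\<Sum>y\<in>?E. overlap v y) \<le> leaves b n * B" if "v \<in> ?E" for v
  proof -
    have "(\<Sum>y\<in>?E. overlap v y) \<le> real (card ?E) * B"
      using B that by (intro sum_bounded_above order_trans[OF overlap_le]) (simp add: shallow_def)
    then show ?thesis by (simp add: card_external[OF T])
  qed
  show "0 \<le> overlaps ?E"
    unfolding overlaps_def by (intro sum_nonneg nonneg) simp
  have "overlaps ?E \<le> real (card ?E) * (leaves b n * B)"
    unfolding overlaps_def by (intro sum_bounded_above le)
  then show "overlaps ?E \<le> (leaves b n)\<^sup>2 * B"
    by (simp add: card_external[OF T] power2_eq_square)
qed

text \<open>
  The conditional mean of the overlaps of the next tree is \<open>(1 + 2 * (b - 1) / m)\<close> times the present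
  value, for \<open>m\<close> leaves, up to a term of the order of the height. Division by the squared number of leaves
  cancels the factor, as \<open>m\<^sup>2 + 2 * (b - 1) * m \<le> (m + b - 1)\<^sup>2\<close>, and leaves a mean increment of order \<open>B / n\<^sup>2\<close>.
\<close>

lemma mean_overlap_controlled: "controlled_process b Q C \<mu> (\<lambda>n T w. mean_overlap n T) increment_bound"
proof unfold_locales
  show "1 \<le> increment_bound" by (rule increment_bound_ge)
  show "(\<lambda>w. mean_overlap n T) \<in> borel_measurable \<W>" for n T
    by simp
next
  fix n T assume T: "grown b n T"
  have ln0: "0 \<le> ln n" using grown_pos[OF T] by simp
  obtain v where v: "v \<in> external b T" "shallow b (length v) T"
    using external_deepest[OF T] b by auto
  have "mean_overlap n T \<le> 1 * real (length v)"
    using overlaps_bounds(2)[OF T v(2)] leaves_pos[of n] by (simp add: mean_overlap_def field_simps)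
  also have "\<dots> \<le> increment_bound * (1 + ln n + length v)"
    using increment_bound_ge(4) ln0 by (intro mult_mono) auto
  finally show "\<exists>v\<in>external b T. mean_overlap n T \<le> increment_bound * (1 + ln n + length v)"
    using v(1) by auto
next
  fix n T B v
  assume T: "grown b n T" and B: "1 \<le> B" "shallow b B T" and v: "v \<in> external b T"
  have n: "n \<ge> 1" by (rule grown_pos[OF T])
  define d where "d = real b - 1"
  define m where "m = leaves b n"
  define m' where "m' = leaves b (Suc n)"
  define G where "G = overlaps (external b T)"
  define S where "S = (\<Sum>y\<in>external b T. overlap v y)"
  have d: "1 \<le> d" "d \<le> b" using b by (auto simp: d_def)
  have m: "1 \<le> m" "m' = m + d" "real n \<le> m'" "0 < m'"
    using leaves_ge[OF b, of n] leaves_ge[OF b, of "Suc n"] by (auto simp: m_def m'_def d_def leaves_Suc)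
  have G: "0 \<le> G" "G \<le> m\<^sup>2 * B" and S: "0 \<le> S" "S \<le> m * B"
    using overlaps_bounds[OF T B(2)] v by (auto simp: G_def S_def m_def)
  have l: "real (length v) \<le> B" using B(2) v by (auto simp: shallow_def)
  \<comment> \<open>The growth of the overlaps is nonnegative, and so is the loss through the larger denominator:\<close>
  \<comment> \<open>the absolute value of their difference is at most the larger of the two.\<close>
  define I where "I = 2 * d * S + d\<^sup>2 * length v + b"
  have I0: "0 \<le> I" using d S by (simp add: I_def)
  have "I \<le> 2 * b * (m' * B) + b * (m' * B) + b * (m' * B)"
    unfolding I_def
  proof (intro add_mono)
    have "S \<le> m' * B" using S(2) B(1) m d by (smt (verit) mult_right_mono)
    then show "2 * d * S \<le> 2 * b * (m' * B)" using d S by (intro mult_mono) auto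
    have "d * (d * real (length v)) \<le> b * (m' * B)"
      using d l m B(1) by (intro mult_mono mult_nonneg_nonneg) auto
    then show "d\<^sup>2 * length v \<le> b * (m' * B)" by (simp add: power2_eq_square mult.assoc)
    have "1 * 1 \<le> m' * B" using m d B(1) by (intro mult_mono) auto
    then show "real b \<le> b * (m' * B)" using mult_left_mono[of 1 "m' * B" "real b"] by simp
  qed
  then have I1: "I \<le> 4 * b * B * m'" by (simp add: algebra_simps)
  have step: "mean_overlap (Suc n) (insert v T) - mean_overlap n T = I / m'\<^sup>2 - G * (1 / m\<^sup>2 - 1 / m'\<^sup>2)"
    unfolding mean_overlap_def overlaps_external_insert[OF T v] I_def
    by (simp add: G_def S_def m_def m'_def d_def add_divide_distrib right_diff_distrib)
  have a: "0 \<le> I / m'\<^sup>2" "I / m'\<^sup>2 \<le> 4 * b * B / m'"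
  proof -
    show "0 \<le> I / m'\<^sup>2" using I0 by simp
    have "I / m'\<^sup>2 \<le> 4 * b * B * m' / m'\<^sup>2" using I1 by (intro divide_right_mono) auto
    then show "I / m'\<^sup>2 \<le> 4 * b * B / m'" using m by (simp add: power2_eq_square)
  qed
  have mm: "m\<^sup>2 \<le> m'\<^sup>2" using m d by (intro power_mono) auto
  have c: "0 \<le> G * (1 / m\<^sup>2 - 1 / m'\<^sup>2)" "G * (1 / m\<^sup>2 - 1 / m'\<^sup>2) \<le> 4 * b * B / m'"
  proof -
    have pos: "0 \<le> 1 / m\<^sup>2 - 1 / m'\<^sup>2" using mm m by (simp add: frac_le)
    then show "0 \<le> G * (1 / m\<^sup>2 - 1 / m'\<^sup>2)" using G by simp
    have "G * (1 / m\<^sup>2 - 1 / m'\<^sup>2) \<le> m\<^sup>2 * B * (1 / m\<^sup>2 - 1 / m'\<^sup>2)"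
      using pos G by (intro mult_right_mono)
    also have "\<dots> = B * (d * (m + m')) / m'\<^sup>2"
    proof -
      have e: "d * (m + m') = m'\<^sup>2 - m\<^sup>2"
        unfolding m(2) by (simp add: power2_eq_square algebra_simps)
      show ?thesis unfolding e using m(1,4) by (simp add: field_simps)
    qed
    also have "\<dots> \<le> B * (b * (2 * m')) / m'\<^sup>2"
      using B(1) d m by (intro divide_right_mono mult_left_mono mult_mono) auto
    also have "\<dots> = 2 * b * B / m'" using m(4) by (simp add: power2_eq_square)
    also have "\<dots> \<le> 4 * b * B / m'" using m B(1) by (intro divide_right_mono mult_right_mono) auto
    finally show "G * (1 / m\<^sup>2 - 1 / m'\<^sup>2) \<le> 4 * b * B / m'" .
  qed
  have "\<bar>mean_overlap (Suc n) (insert v T) - mean_overlap n T\<bar> \<le> 4 * b * B / m'"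
    unfolding step using a c by linarith
  also have "\<dots> \<le> increment_bound * B / n"
  proof (intro frac_le mult_right_mono)
    have "1 * real b \<le> (real b)\<^sup>2"
      unfolding power2_eq_square using b by (intro mult_right_mono) auto
    then have "4 * real b \<le> increment_bound" using increment_bound_ge(2) by linarith
    then show "real (4 * b) \<le> increment_bound" by simp
  qed (use n m B(1) increment_bound_ge(4) in auto)
  finally show "\<bar>mean_overlap (Suc n) (insert v T) - mean_overlap n T\<bar> \<le> increment_bound * B / n" .
next
  fix n T B assume T: "grown b n T" and B: "1 \<le> B" "shallow b B T"
  let ?E = "external b T"
  have n: "n \<ge> 1" by (rule grown_pos[OF T])
  define d where "d = real b - 1"
  define m where "m = leaves b n"
  define m' where "m' = leaves b (Suc n)"
  define G where "G = overlaps ?E"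
  have d: "1 \<le> d" "d \<le> b" using b by (auto simp: d_def)
  have m: "1 \<le> m" "m' = m + d" "real n \<le> m'" "0 < m'"
    using leaves_ge[OF b, of n] leaves_ge[OF b, of "Suc n"] by (auto simp: m_def m'_def d_def leaves_Suc)
  have G: "0 \<le> G" using overlaps_bounds(1)[OF T B(2)] by (simp add: G_def)
  have card: "real (card ?E) = m" using card_external[OF T] by (simp add: m_def)
  have "(\<Sum>v\<in>?E. mean_overlap (Suc n) (insert v T) - mean_overlap n T)
      = (\<Sum>v\<in>?E. (G + 2 * d * (\<Sum>y\<in>?E. overlap v y) + d\<^sup>2 * length v + b) / m'\<^sup>2 - G / m\<^sup>2)"
    by (intro sum.cong refl)
      (simp add: mean_overlap_def overlaps_external_insert[OF T] G_def d_def m_def m'_def)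
  also have "\<dots> = (m * G + 2 * d * G + (\<Sum>v\<in>?E. d\<^sup>2 * length v + b)) / m'\<^sup>2 - m * (G / m\<^sup>2)"
    using card by (simp add: sum.distrib sum_subtractf G_def overlaps_def add.assoc
        flip: sum_divide_distrib sum_distrib_left)
  also have "\<dots> \<le> m * ((2 * (real b)\<^sup>2 * B) / m'\<^sup>2)"
  proof -
    have "(\<Sum>v\<in>?E. d\<^sup>2 * length v + b) \<le> real (card ?E) * ((real b)\<^sup>2 * B + (real b)\<^sup>2 * B)"
    proof (rule sum_bounded_above)
      fix v assume "v \<in> ?E"
      then have l: "real (length v) \<le> B" using B(2) by (auto simp: shallow_def)
      have "real b * 1 \<le> real b * (real b * B)"
        using b B(1) mult_mono[of 1 "real b" 1 B] by (intro mult_left_mono) auto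
      moreover have "d\<^sup>2 * length v \<le> (real b)\<^sup>2 * B"
        using d l by (intro mult_mono power_mono) auto
      ultimately show "d\<^sup>2 * length v + b \<le> (real b)\<^sup>2 * B + (real b)\<^sup>2 * B"
        by (simp add: power2_eq_square algebra_simps)
    qed
    then have "(\<Sum>v\<in>?E. d\<^sup>2 * length v + b) / m'\<^sup>2 \<le> m * (2 * (real b)\<^sup>2 * B) / m'\<^sup>2"
      unfolding card by (intro divide_right_mono) (simp_all add: ac_simps)
    moreover have "(m * G + 2 * d * G) / m'\<^sup>2 \<le> m * (G / m\<^sup>2)"
    proof -
      have "m * (m + 2 * d) \<le> m'\<^sup>2" unfolding m(2) by (simp add: power2_eq_square algebra_simps)
      then have "(m + 2 * d) / m'\<^sup>2 \<le> 1 / m"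
        using m(1,4) by (simp add: pos_divide_le_eq pos_le_divide_eq mult.commute)
      then have "G * ((m + 2 * d) / m'\<^sup>2) \<le> G * (1 / m)" using G by (intro mult_left_mono)
      then show ?thesis using m(1) by (simp add: power2_eq_square distrib_left ac_simps)
    qed
    ultimately show ?thesis by (simp add: add_divide_distrib)
  qed
  also have "\<dots> \<le> m * (increment_bound * B / (real n)\<^sup>2)"
  proof (intro mult_left_mono frac_le mult_right_mono power_mono)
    have "0 \<le> (real b)\<^sup>2" by simp
    then show "2 * (real b)\<^sup>2 \<le> increment_bound" using increment_bound_ge(2) by linarith
  qed (use n m B(1) increment_bound_ge(4) in auto)
  finally show "(\<Sum>v\<in>?E. LINT z|Q. mean_overlap (Suc n) (insert v T) - mean_overlap n T)
      \<le> leaves b n * (increment_bound * B / (real n)\<^sup>2)"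
    by (simp add: Q.prob_space m_def)
qed

section \<open>Deviations from a deterministic centre\<close>

abbreviation \<M> :: "nat \<Rightarrow> (node set \<times> (node \<Rightarrow> nat \<Rightarrow> real)) measure" where
  "\<M> n \<equiv> weighted_tree b Q n"

lemma \<M>_eq: "\<M> n = measure_pmf (recursive_tree b n) \<Otimes>\<^sub>M \<W>"
  by (simp add: weighted_tree_def \<W>_def)

lemma prob_space_\<M>: "prob_space (\<M> n)"
proof -
  interpret pair_prob_space "measure_pmf (recursive_tree b n)" \<W> ..
  show ?thesis unfolding \<M>_eq by (rule prob_space_axioms)
qed

lemma AE_\<M>:
  assumes "n \<ge> 1" and P: "\<And>T w. grown b n T \<Longrightarrow> admissible b C w \<Longrightarrow> P (T, w)"
    and meas: "{x \<in> space (\<M> n). P x} \<in> sets (\<M> n)"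
  shows "AE x in \<M> n. P x"
proof -
  interpret pair_prob_space "measure_pmf (recursive_tree b n)" \<W> ..
  have "AE T in measure_pmf (recursive_tree b n). AE w in \<W>. P (T, w)"
  proof (rule AE_pmfI)
    fix T assume "T \<in> set_pmf (recursive_tree b n)"
    then have T: "grown b n T"
      using set_pmf_recursive_tree[of b T "n - 1"] b assms(1) by simp
    show "AE w in \<W>. P (T, w)"
      using AE_admissible by eventually_elim (rule P[OF T])
  qed
  then show ?thesis
    unfolding \<M>_eq by (rule AE_pair_measure[OF meas[unfolded \<M>_eq]])
qed

lemma emeasure_\<M>: "A \<in> sets (\<M> n) \<Longrightarrow> emeasure (\<M> n) A = expect n (\<lambda>T w. indicator A (T, w))"
  unfolding \<M>_eq expect_def by (rule \<W>.emeasure_pair_measure)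

lemma expect_add:
  assumes "\<And>T. f T \<in> borel_measurable \<W>" "\<And>T. g T \<in> borel_measurable \<W>"
  shows "expect n (\<lambda>T w. f T w + g T w) = expect n f + expect n g"
  unfolding expect_def using assms by (simp add: nn_integral_add)

text \<open>
  A union bound over the upward and downward fluctuation and the overlap. The loss of a factor 2 in the exponent
  absorbs the number of events.
\<close>

lemma deviation_bound:
  assumes s: "s > 0"
  shows "\<forall>\<^sub>F n in sequentially. \<forall>A\<in>sets (\<M> n).
    (\<forall>T w. grown b n T \<longrightarrow> admissible b C w \<longrightarrow> (T, w) \<in> A \<longrightarrow>
      s * ln n < \<bar>fluctuation n T w\<bar> \<or> s * ln n < mean_overlap n T) \<longrightarrow>
    measure (\<M> n) A \<le> exp (- (s / (8 * increment_bound)) * ln n * ln (ln n))"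
proof -
  interpret up: controlled_process b Q C \<mu> "\<lambda>n T w. 1 * fluctuation n T w" increment_bound
    by (rule fluctuation_controlled) simp
  interpret down: controlled_process b Q C \<mu> "\<lambda>n T w. - 1 * fluctuation n T w" increment_bound
    by (rule fluctuation_controlled) simp
  interpret lap: controlled_process b Q C \<mu> "\<lambda>n T w. mean_overlap n T" increment_bound
    by (rule mean_overlap_controlled)
  define k where "k = s / (8 * increment_bound)"
  have k: "k > 0" "s / (4 * increment_bound) = 2 * k"
    using s increment_bound_ge(4) by (auto simp: k_def)
  have small: "\<forall>\<^sub>F n :: nat in sequentially. 3 * exp (- (2 * k) * ln n * ln (ln n)) \<le> exp (- k * ln n * ln (ln n))"
    using k(1) by real_asymp
  show ?thesis
    using up.tail_asymptotic[OF s] down.tail_asymptotic[OF s] lap.tail_asymptotic[OF s] small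
      eventually_ge_at_top[of 1]
  proof eventually_elim
    case (elim n)
    let ?x = "s * ln n"
    let ?I1 = "\<lambda>T w. indicator {w. ?x < 1 * fluctuation n T w} w :: ennreal"
    let ?I2 = "\<lambda>T w. indicator {w. ?x < - 1 * fluctuation n T w} w :: ennreal"
    let ?I3 = "\<lambda>T w. indicator {w. ?x < mean_overlap n T} w :: ennreal"
    let ?e = "exp (- (2 * k) * ln n * ln (ln n))"
    have meas: "?I1 T \<in> borel_measurable \<W>" "?I2 T \<in> borel_measurable \<W>" "?I3 T \<in> borel_measurable \<W>" for T
      using up.F_measurable[of n T] by (auto intro!: borel_measurable_indicator')
    show ?case
    proof (intro ballI impI)
      fix A assume A: "A \<in> sets (\<M> n)" and
        sub: "\<forall>T w. grown b n T \<longrightarrow> admissible b C w \<longrightarrow> (T, w) \<in> A \<longrightarrow>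
          ?x < \<bar>fluctuation n T w\<bar> \<or> ?x < mean_overlap n T"
      interpret M: prob_space "\<M> n" by (rule prob_space_\<M>)
      have "ennreal (measure (\<M> n) A) = expect n (\<lambda>T w. indicator A (T, w))"
        using emeasure_\<M>[OF A] by (simp add: M.emeasure_eq_measure)
      also have "\<dots> \<le> expect n (\<lambda>T w. (?I1 T w + ?I2 T w) + ?I3 T w)"
      proof (rule expect_mono[OF _ elim(5)])
        fix T w assume T: "grown b n T" and w: "admissible b C w"
        show "(indicator A (T, w) :: ennreal) \<le> (?I1 T w + ?I2 T w) + ?I3 T w"
        proof (cases "(T, w) \<in> A")
          case True
          then have "?x < 1 * fluctuation n T w \<or> ?x < - 1 * fluctuation n T w \<or> ?x < mean_overlap n T"
            using sub T w by fastforce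
          then show ?thesis by (auto simp: indicator_def)
        qed simp
      qed
      also have "\<dots> = (expect n ?I1 + expect n ?I2) + expect n ?I3"
        using meas by (simp only: expect_add borel_measurable_add)
      also have "\<dots> \<le> (ennreal ?e + ennreal ?e) + ennreal ?e"
        using elim(1-3) unfolding k(2) by (intro add_mono)
      also have "\<dots> = ennreal (3 * ?e)"
        by (simp flip: ennreal_plus)
      finally have "measure (\<M> n) A \<le> 3 * ?e" by simp
      then show "measure (\<M> n) A \<le> exp (- (s / (8 * increment_bound)) * ln n * ln (ln n))"
        using elim(4) unfolding k_def by linarith
    qed
  qed
qed

text \<open>
  The value of the internal path length at vanishing fluctuation, without the linear contribution of the weights.
\<close>

definition centre :: "nat \<Rightarrow> real" where
  "centre n = leaves b n * drift n / (real b - 1)"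

lemma internal_path_eq: "internal_path_length (T, w) = (\<Sum>u\<in>T. depth w u)"
  by (simp add: internal_path_length_def distance_root)

text \<open>
  The constant \<open>C\<close> next to the fluctuation accounts for the total weight by which the two path lengths
  differ.
\<close>

lemma internal_path_deviation:
  assumes T: "grown b n T" and w: "admissible b C w"
  shows "\<bar>internal_path_length (T, w) - centre n\<bar> \<le> b * n * (\<bar>fluctuation n T w\<bar> + C)"
proof -
  have n: "n \<ge> 1" by (rule grown_pos[OF T])
  let ?P = "internal_path_length (T, w)"
  let ?S = "\<Sum>u\<in>T. \<Sum>i<b. w u i"
  have wb: "0 \<le> w u i \<and> w u i \<le> C" if "u \<in> T" "i < b" for u i
    using w grown_nodes[OF T] that unfolding admissible_def by blast
  have "?S \<le> real (card T) * (b * C)"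
  proof (rule sum_bounded_above)
    fix u assume "u \<in> T"
    then show "(\<Sum>i<b. w u i) \<le> b * C"
      using sum_bounded_above[of "{..<b}" "w u" C] wb by simp
  qed
  then have S: "0 \<le> ?S" "?S \<le> n * (b * C)"
    using wb grown_card[OF T] by (auto intro!: sum_nonneg)
  have "(real b - 1) * (?P - centre n) = leaves b n * fluctuation n T w - ?S"
    using internal_external_path[OF T, of w] leaves_pos[of n] b
    by (simp add: internal_path_eq centre_def fluctuation_def right_diff_distrib)
  moreover have "\<bar>leaves b n * fluctuation n T w\<bar> \<le> b * n * \<bar>fluctuation n T w\<bar>"
    using leaves_le[of b n] leaves_pos[of n] b n by (simp add: abs_mult mult_right_mono)
  ultimately have le: "\<bar>(real b - 1) * (?P - centre n)\<bar> \<le> b * n * \<bar>fluctuation n T w\<bar> + n * (b * C)"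
    using S by linarith
  have "\<bar>?P - centre n\<bar> = 1 * \<bar>?P - centre n\<bar>" by simp
  also have "\<dots> \<le> (real b - 1) * \<bar>?P - centre n\<bar>"
    using b by (intro mult_right_mono) auto
  also have "\<dots> = \<bar>(real b - 1) * (?P - centre n)\<bar>"
    using b by (simp add: abs_mult)
  also note le
  finally have "\<bar>?P - centre n\<bar> \<le> b * n * \<bar>fluctuation n T w\<bar> + n * (b * C)" .
  then show ?thesis by (simp add: algebra_simps)
qed

lemma centre_bounds:
  assumes n: "n \<ge> 1"
  shows "\<mu> * (n * ln n) \<le> centre n" "0 \<le> centre n" "centre n \<le> (real b)\<^sup>2 * C * (real n)\<^sup>2"
proof -
  let ?H = "\<Sum>k=1..n. 1 / leaves b k"
  have d: "1 \<le> real b - 1" using b by simp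
  have "ln n \<le> harm n"
    using harm_ge_ln[of n] n by (smt (verit) ln_le_cancel_iff of_nat_0_le_iff of_nat_1 of_nat_le_iff)
  also have "harm n = b * (\<Sum>k=1..n. 1 / (b * k))"
    using b by (simp add: harm_def sum_distrib_left inverse_eq_divide)
  also have "(\<Sum>k=1..n. 1 / (b * k)) \<le> ?H"
    using leaves_le b leaves_pos by (intro sum_mono divide_left_mono mult_pos_pos) auto
  finally have H: "ln n \<le> b * ?H" by (simp add: mult_left_mono)
  have "(real b - 1) * n * (\<mu> * ln n) \<le> leaves b n * (\<mu> * (b * ?H))"
    using H mu_pos n d by (intro mult_mono) (auto simp: leaves_def)
  then show "\<mu> * (n * ln n) \<le> centre n"
    using d by (simp add: centre_def drift_def field_simps)
  show "0 \<le> centre n"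
    unfolding centre_def using drift_nonneg leaves_pos[of n] d by simp
  have "1 \<le> leaves b k" for k
    using leaves_ge[OF b, of k] by linarith
  then have "?H \<le> (\<Sum>k=1..n. 1)"
    using leaves_pos by (intro sum_mono) (simp add: divide_le_eq)
  then have "drift n \<le> b * C * n"
    unfolding drift_def using mu_pos mu_le by (intro mult_mono) (auto intro!: sum_nonneg simp: leaves_pos less_imp_le)
  then have "leaves b n * drift n \<le> (b * n) * (b * C * n)"
    using leaves_le[of b n] b n drift_nonneg by (intro mult_mono) auto
  moreover have "centre n \<le> leaves b n * drift n / 1"
    unfolding centre_def using d drift_nonneg[of n] leaves_pos[of n] by (intro divide_left_mono) auto
  ultimately show "centre n \<le> (real b)\<^sup>2 * C * (real n)\<^sup>2"
    by (simp add: power2_eq_square ac_simps)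
qed

lemma wiener_deviation:
  assumes T: "grown b n T" and w: "admissible b C w"
  shows "\<bar>wiener_index (T, w) - n * centre n\<bar>
    \<le> b * (real n)\<^sup>2 * (\<bar>fluctuation n T w\<bar> + C) + C * (real b)\<^sup>2 * (real n)\<^sup>2 * mean_overlap n T"
proof -
  have n: "n \<ge> 1" by (rule grown_pos[OF T])
  let ?R = "\<Sum>u\<in>T. \<Sum>v\<in>T. depth w (lcp u v)"
  have "overlaps (external b T) = (leaves b n)\<^sup>2 * mean_overlap n T"
    using leaves_pos[of n] by (simp add: mean_overlap_def)
  also have "\<dots> \<le> (real b * real n)\<^sup>2 * mean_overlap n T"
  proof (rule mult_right_mono)
    show "(leaves b n)\<^sup>2 \<le> (real b * real n)\<^sup>2"
      using leaves_le[of b n] leaves_pos[of n] b n by (intro power_mono) auto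
    show "0 \<le> mean_overlap n T"
      by (auto simp: mean_overlap_def overlaps_def intro!: divide_nonneg_nonneg sum_nonneg)
  qed
  finally have "C * overlaps (external b T) \<le> C * ((real b * real n)\<^sup>2 * mean_overlap n T)"
    using C by (intro mult_left_mono) auto
  also have "\<dots> = C * (real b)\<^sup>2 * (real n)\<^sup>2 * mean_overlap n T"
    by (simp add: power_mult_distrib)
  finally have R: "0 \<le> ?R" "?R \<le> C * (real b)\<^sup>2 * (real n)\<^sup>2 * mean_overlap n T"
    using sum_depth_lcp_bounds[OF T b w] C by linarith+
  have "wiener_index (T, w) - n * centre n = n * (internal_path_length (T, w) - centre n) - ?R"
    using wiener_index_eq[OF grown_finite[OF T], of w] grown_card[OF T] by (simp add: right_diff_distrib)
  moreover have "\<bar>n * (internal_path_length (T, w) - centre n)\<bar> \<le> n * (b * n * (\<bar>fluctuation n T w\<bar> + C))"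
    using internal_path_deviation[OF T w] by (simp add: abs_mult mult_left_mono)
  moreover have "n * (b * n * (\<bar>fluctuation n T w\<bar> + C)) = b * (real n)\<^sup>2 * (\<bar>fluctuation n T w\<bar> + C)"
    by (simp add: power2_eq_square)
  ultimately show ?thesis using R by linarith
qed

lemma internal_path_bounds:
  assumes T: "grown b n T" and w: "admissible b C w"
  shows "0 \<le> internal_path_length (T, w)" "internal_path_length (T, w) \<le> C * (real n)\<^sup>2"
proof -
  have *: "0 \<le> depth w u \<and> depth w u \<le> C * n" if "u \<in> T" for u
  proof -
    have "C * length u \<le> C * n"
      using length_internal_le[OF T that] C by (intro mult_left_mono) auto
    then show ?thesis
      using depth_bounds[OF w, of u] grown_nodes[OF T] that by fastforce
  qed
  show "0 \<le> internal_path_length (T, w)"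
    unfolding internal_path_eq using * by (intro sum_nonneg) auto
  have "internal_path_length (T, w) \<le> real (card T) * (C * n)"
    unfolding internal_path_eq using * by (intro sum_bounded_above) auto
  then show "internal_path_length (T, w) \<le> C * (real n)\<^sup>2"
    by (simp add: grown_card[OF T] power2_eq_square ac_simps)
qed

lemma wiener_bounds:
  assumes T: "grown b n T" and w: "admissible b C w"
  shows "\<bar>wiener_index (T, w)\<bar> \<le> (real b)\<^sup>2 * C * (real n) ^ 3"
proof -
  have n: "n \<ge> 1" by (rule grown_pos[OF T])
  let ?R = "\<Sum>u\<in>T. \<Sum>v\<in>T. depth w (lcp u v)"
  have W: "wiener_index (T, w) = n * internal_path_length (T, w) - ?R"
    using wiener_index_eq[OF grown_finite[OF T], of w] grown_card[OF T] by simp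
  have shallow: "shallow b (real n) T"
    using length_external_le[OF T] by (simp add: shallow_def)
  have "C * overlaps (external b T) \<le> C * ((real b * real n)\<^sup>2 * n)"
    using overlaps_bounds(2)[OF T shallow] leaves_le[of b n] leaves_pos[of n] b n C
    by (intro mult_left_mono order_trans[OF overlaps_bounds(2)[OF T shallow]] mult_right_mono power_mono) auto
  also have "\<dots> = (real b)\<^sup>2 * C * (real n) ^ 3"
    by (simp add: power2_eq_square power3_eq_cube)
  finally have R: "0 \<le> ?R" "?R \<le> (real b)\<^sup>2 * C * (real n) ^ 3"
    using sum_depth_lcp_bounds[OF T b w] C by linarith+
  have "n * internal_path_length (T, w) \<le> n * (C * (real n)\<^sup>2)"
    using internal_path_bounds[OF T w] by (intro mult_left_mono) auto
  also have "\<dots> = 1 * (C * (real n) ^ 3)"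
    by (simp add: power2_eq_square power3_eq_cube)
  also have "\<dots> \<le> (real b)\<^sup>2 * (C * (real n) ^ 3)"
    using b C by (intro mult_right_mono one_le_power) auto
  finally have "n * internal_path_length (T, w) \<le> (real b)\<^sup>2 * C * (real n) ^ 3"
    by (simp add: mult.assoc)
  moreover have "0 \<le> n * internal_path_length (T, w)"
    using internal_path_bounds[OF T w] by simp
  ultimately show ?thesis using R unfolding W by linarith
qed

lemma measurable_deviation:
  "{x \<in> space (\<M> n). y < \<bar>internal_path_length x - m\<bar>} \<in> sets (\<M> n)"
  "{x \<in> space (\<M> n). y < \<bar>wiener_index x - m\<bar>} \<in> sets (\<M> n)"
  using internal_path_length_measurable[OF sets_Q, of n] wiener_index_measurable[OF sets_Q, of n]
  by measurable

text \<open>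
  On the scale \<open>n * ln n\<close> (or \<open>n\<^sup>2 * ln n\<close>) the linear error terms are eventually negligible, so a large
  deviation of the statistic forces a proportionally large fluctuation or overlap.
\<close>

lemma centred_tails:
  assumes s: "s > 0"
  shows "\<forall>\<^sub>F n in sequentially.
      measure (\<M> n) {x \<in> space (\<M> n). s * (n * ln n) < \<bar>internal_path_length x - centre n\<bar>}
        \<le> exp (- (1 / (8 * increment_bound\<^sup>2) * s) * ln n * ln (ln n))"
    "\<forall>\<^sub>F n in sequentially.
      measure (\<M> n) {x \<in> space (\<M> n). s * ((real n)\<^sup>2 * ln n) < \<bar>wiener_index x - n * centre n\<bar>}
        \<le> exp (- (1 / (8 * increment_bound\<^sup>2) * s) * ln n * ln (ln n))"
proof -
  \<comment> \<open>With this level the fluctuation uses up half of \<open>s\<close> and the overlap a quarter, leaving a quarter to the linear terms.\<close>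
  define r where "r = s / increment_bound"
  have r: "r > 0" "r / (8 * increment_bound) = 1 / (8 * increment_bound\<^sup>2) * s"
    using s increment_bound_ge(4) by (auto simp: r_def power2_eq_square)
  have "real b * 1 \<le> real b * C" using C b by (intro mult_left_mono) auto
  then have "2 * b \<le> increment_bound" using increment_bound_ge(1) by linarith
  then have br: "b * r \<le> s / 2"
    using s increment_bound_ge(4) by (simp add: r_def field_simps)
  have Cr: "C * (real b)\<^sup>2 * r = s / 4"
    using increment_bound_ge(4) C b by (simp add: r_def increment_bound_def)
  have large: "\<forall>\<^sub>F n :: nat in sequentially. b * C \<le> s / 4 * ln n"
    using s by real_asymp
  have both: "\<forall>\<^sub>F n in sequentially.
      measure (\<M> n) {x \<in> space (\<M> n). s * (n * ln n) < \<bar>internal_path_length x - centre n\<bar>}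
        \<le> exp (- (r / (8 * increment_bound)) * ln n * ln (ln n)) \<and>
      measure (\<M> n) {x \<in> space (\<M> n). s * ((real n)\<^sup>2 * ln n) < \<bar>wiener_index x - n * centre n\<bar>}
        \<le> exp (- (r / (8 * increment_bound)) * ln n * ln (ln n))"
    using deviation_bound[OF r(1)] large
  proof eventually_elim
    case (elim n)
    have P: "\<bar>internal_path_length (T, w) - centre n\<bar> \<le> s * (n * ln n)"
      if T: "grown b n T" "admissible b C w" and small: "\<bar>fluctuation n T w\<bar> \<le> r * ln n" for T w
    proof -
      have l: "0 \<le> ln n" using grown_pos[OF T(1)] by simp
      have "b * (\<bar>fluctuation n T w\<bar> + C) \<le> b * r * ln n + b * C"
        using small mult_left_mono[OF small, of b] by (simp add: distrib_left)
      also have "\<dots> \<le> s / 2 * ln n + s / 4 * ln n"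
        using br l elim(2) by (intro add_mono mult_right_mono) auto
      also have "\<dots> \<le> s * ln n" using s l by simp
      finally have "n * (b * (\<bar>fluctuation n T w\<bar> + C)) \<le> n * (s * ln n)"
        by (intro mult_left_mono) auto
      then show ?thesis
        using internal_path_deviation[OF T] by (simp add: ac_simps)
    qed
    have W: "\<bar>wiener_index (T, w) - n * centre n\<bar> \<le> s * ((real n)\<^sup>2 * ln n)"
      if T: "grown b n T" "admissible b C w" and small: "\<bar>fluctuation n T w\<bar> \<le> r * ln n"
        and over: "mean_overlap n T \<le> r * ln n" for T w
    proof -
      have l: "0 \<le> ln n" using grown_pos[OF T(1)] by simp
      have "b * (\<bar>fluctuation n T w\<bar> + C) \<le> b * r * ln n + b * C"
        using small mult_left_mono[OF small, of b] by (simp add: distrib_left)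
      also have "\<dots> \<le> s / 2 * ln n + s / 4 * ln n"
        using br l elim(2) by (intro add_mono mult_right_mono) auto
      finally have 1: "b * (\<bar>fluctuation n T w\<bar> + C) \<le> s / 2 * ln n + s / 4 * ln n" .
      have "C * (real b)\<^sup>2 * mean_overlap n T \<le> C * (real b)\<^sup>2 * (r * ln n)"
        using over C by (intro mult_left_mono) auto
      also have "\<dots> = s / 4 * ln n" by (simp only: Cr flip: mult.assoc)
      finally have "b * (\<bar>fluctuation n T w\<bar> + C) + C * (real b)\<^sup>2 * mean_overlap n T \<le> s * ln n"
        using 1 by (simp add: field_simps)
      then have "(real n)\<^sup>2 * (b * (\<bar>fluctuation n T w\<bar> + C) + C * (real b)\<^sup>2 * mean_overlap n T)
          \<le> (real n)\<^sup>2 * (s * ln n)"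
        by (intro mult_left_mono) auto
      then show ?thesis
        using wiener_deviation[OF T] by (simp add: algebra_simps)
    qed
    note bound = elim(1)[rule_format, rotated]
    show ?case
      by (intro conjI bound measurable_deviation; use P W in \<open>fastforce simp: not_less\<close>)
  qed
  show "\<forall>\<^sub>F n in sequentially.
      measure (\<M> n) {x \<in> space (\<M> n). s * (n * ln n) < \<bar>internal_path_length x - centre n\<bar>}
        \<le> exp (- (1 / (8 * increment_bound\<^sup>2) * s) * ln n * ln (ln n))"
    "\<forall>\<^sub>F n in sequentially.
      measure (\<M> n) {x \<in> space (\<M> n). s * ((real n)\<^sup>2 * ln n) < \<bar>wiener_index x - n * centre n\<bar>}
        \<le> exp (- (1 / (8 * increment_bound\<^sup>2) * s) * ln n * ln (ln n))"
    using both unfolding r(2) by (auto elim: eventually_mono)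
qed

end

section \<open>From the centre to the mean\<close>

text \<open>
  Off the deviation event the distance is at most \<open>y\<close>, on it at most \<open>2 * a\<close>.
\<close>

lemma (in prob_space) expectation_near_centre:
  fixes V :: "'a \<Rightarrow> real"
  assumes V: "V \<in> borel_measurable M" and bound: "AE x in M. \<bar>V x\<bar> \<le> a" and c: "\<bar>c\<bar> \<le> a" and y: "0 \<le> y"
  shows "\<bar>expectation V - c\<bar> \<le> y + 2 * a * prob {x \<in> space M. y < \<bar>V x - c\<bar>}"
proof -
  let ?A = "{x \<in> space M. y < \<bar>V x - c\<bar>}"
  have A: "?A \<in> events" using V by measurable
  have intV: "integrable M V"
    using V bound by (intro integrable_const_bound[where B = a]) auto
  have "\<bar>expectation V - c\<bar> = \<bar>expectation (\<lambda>x. V x - c)\<bar>"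
    using intV by (simp add: prob_space)
  also have "\<dots> \<le> expectation (\<lambda>x. \<bar>V x - c\<bar>)"
    by (rule integral_abs_bound)
  also have "\<dots> \<le> expectation (\<lambda>x. y + 2 * a * indicator ?A x)"
  proof (rule integral_mono_AE)
    show "integrable M (\<lambda>x. \<bar>V x - c\<bar>)" using intV by simp
    show "integrable M (\<lambda>x. y + 2 * a * indicator ?A x)"
      using A by (intro Bochner_Integration.integrable_add integrable_mult_right integrable_const
          integrable_real_indicator) (auto simp: emeasure_eq_measure)
    show "AE x in M. \<bar>V x - c\<bar> \<le> y + 2 * a * indicator ?A x"
      using bound AE_space
    proof eventually_elim
      case (elim x)
      then show ?case
        using c y by (cases "x \<in> ?A") auto
    qed
  qed
  also have "\<dots> = y + 2 * a * prob ?A"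
    using A by (simp add: prob_space emeasure_eq_measure)
  finally show ?thesis .
qed

text \<open>
  The tail bound at any level decays faster than every power of \<open>n\<close>, whereas the statistic is polynomially
  bounded; so its mean lies within any given multiple of \<open>r n\<close> of the centre, and deviations from the mean are deviations
  from the centre at a slightly smaller level.
\<close>

lemma tail_about_mean:
  fixes M :: "nat \<Rightarrow> 'b measure" and V :: "'b \<Rightarrow> real" and c r :: "nat \<Rightarrow> real"
  assumes M: "\<And>n. prob_space (M n)" and V: "\<And>n. V \<in> borel_measurable (M n)"
    and pos: "0 < a" "0 < \<delta>" "0 < K"
    and bound: "\<forall>\<^sub>F n in sequentially. AE x in M n. \<bar>V x\<bar> \<le> a * real n ^ 3"
    and centre: "\<forall>\<^sub>F n in sequentially. \<bar>c n\<bar> \<le> a * real n ^ 3 \<and> \<delta> * r n \<le> c n \<and> 1 \<le> r n"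
    and tail: "\<And>s. 0 < s \<Longrightarrow> \<forall>\<^sub>F n in sequentially.
      measure (M n) {x \<in> space (M n). s * r n < \<bar>V x - c n\<bar>} \<le> exp (- (K * s) * ln n * ln (ln n))"
    and t: "0 < t"
  shows "\<forall>\<^sub>F n in sequentially.
    measure (M n) {x \<in> space (M n). t * (LINT x|M n. V x) < \<bar>V x - (LINT x|M n. V x)\<bar>}
      \<le> exp (- (K * \<delta> / 4 * t) * ln n * ln (ln n))"
proof -
  \<comment> \<open>The first bound keeps the shift of the centre below half of the level, the second the mean above half of the centre.\<close>
  define s where "s = min (t * \<delta> / 8) (\<delta> / 4)"
  have s: "0 < s" "s \<le> t * \<delta> / 8" "s \<le> \<delta> / 4"
    using t pos by (auto simp: s_def)
  have "0 < t * \<delta> / 4" using t pos by simp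
  note tail_t = tail[OF this]
  have Ks: "0 < K * s" using pos s by simp
  have small: "\<forall>\<^sub>F n :: nat in sequentially. 2 * (a * real n ^ 3) * exp (- (K * s) * ln n * ln (ln n)) \<le> s"
  proof -
    have "\<forall>\<^sub>F n :: nat in sequentially. 2 * (a * real n ^ 3) * exp (- k * ln n * ln (ln n)) \<le> s" if "0 < k" for k
      using pos(1) that s(1) by real_asymp
    then show ?thesis using Ks by simp
  qed
  show ?thesis
    using bound centre tail[OF s(1)] tail_t small
  proof eventually_elim
    case (elim n)
    interpret prob_space "M n" by (rule M)
    let ?E = "LINT x|M n. V x"
    have r: "1 \<le> r n" "\<delta> * r n \<le> c n" using elim(2) by auto
    have "\<bar>?E - c n\<bar> \<le> s * r n + 2 * (a * real n ^ 3) * measure (M n) {x \<in> space (M n). s * r n < \<bar>V x - c n\<bar>}"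
      using expectation_near_centre[OF V elim(1), of "c n" "s * r n"] elim(2) s(1) by simp
    also have "\<dots> \<le> s * r n + 2 * (a * real n ^ 3) * exp (- (K * s) * ln n * ln (ln n))"
      using elim(3) pos(1) by (intro add_left_mono mult_left_mono) auto
    also have "\<dots> \<le> s * r n + s * r n"
      using elim(5) mult_left_mono[OF r(1), of s] s(1) by linarith
    finally have near: "\<bar>?E - c n\<bar> \<le> 2 * (s * r n)" by simp
    have s1: "s * r n \<le> t * \<delta> / 8 * r n" and s2: "s * r n \<le> \<delta> / 4 * r n"
      using s r(1) by (auto intro!: mult_right_mono)
    have "\<delta> / 2 * r n \<le> ?E" using near s2 r(2) by (simp add: field_simps)
    then have E: "t * (\<delta> / 2 * r n) \<le> t * ?E" using t by (intro mult_left_mono) auto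
    have "{x \<in> space (M n). t * ?E < \<bar>V x - ?E\<bar>} \<subseteq> {x \<in> space (M n). t * \<delta> / 4 * r n < \<bar>V x - c n\<bar>}"
    proof safe
      fix x assume "t * ?E < \<bar>V x - ?E\<bar>"
      then have "t * (\<delta> / 2 * r n) < \<bar>V x - c n\<bar> + 2 * (s * r n)"
        using E near by linarith
      then show "t * \<delta> / 4 * r n < \<bar>V x - c n\<bar>"
        using s1 by (simp add: field_simps)
    qed
    then have "measure (M n) {x \<in> space (M n). t * ?E < \<bar>V x - ?E\<bar>}
        \<le> measure (M n) {x \<in> space (M n). t * \<delta> / 4 * r n < \<bar>V x - c n\<bar>}"
      using V[of n] by (intro finite_measure_mono) measurable
    also have "\<dots> \<le> exp (- (K * (t * \<delta> / 4)) * ln n * ln (ln n))"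
      by (rule elim(4))
    finally show ?case by (simp add: ac_simps)
  qed
qed

context weighted_recursive_tree
begin

lemma tails_about_mean:
  assumes t: "t > 0"
  shows "\<forall>\<^sub>F n in sequentially.
      measure (\<M> n) {x \<in> space (\<M> n). t * (LINT x|\<M> n. internal_path_length x)
          < \<bar>internal_path_length x - (LINT x|\<M> n. internal_path_length x)\<bar>}
        \<le> exp (- (1 / (8 * increment_bound\<^sup>2) * \<mu> / 4 * t) * ln n * ln (ln n))"
    "\<forall>\<^sub>F n in sequentially.
      measure (\<M> n) {x \<in> space (\<M> n). t * (LINT x|\<M> n. wiener_index x)
          < \<bar>wiener_index x - (LINT x|\<M> n. wiener_index x)\<bar>}
        \<le> exp (- (1 / (8 * increment_bound\<^sup>2) * \<mu> / 4 * t) * ln n * ln (ln n))"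
proof -
  let ?a = "(real b)\<^sup>2 * C" and ?K = "1 / (8 * increment_bound\<^sup>2)"
  have pos: "0 < ?a" "0 < ?K" using b C increment_bound_ge(4) by auto
  have meas: "internal_path_length \<in> borel_measurable (\<M> n)" "wiener_index \<in> borel_measurable (\<M> n)" for n
    by (rule internal_path_length_measurable wiener_index_measurable, rule sets_Q)+
  have cube: "?a * (real n)\<^sup>2 \<le> ?a * real n ^ 3" if "n \<ge> 1" for n
    using pos(1) that by (intro mult_left_mono power_increasing) auto
  have P: "AE x in \<M> n. \<bar>internal_path_length x\<bar> \<le> ?a * real n ^ 3" if n: "n \<ge> 1" for n
  proof (rule AE_\<M>[OF n])
    fix T w assume Tw: "grown b n T" "admissible b C w"
    have "1 * C \<le> ?a" using b C by (intro mult_right_mono one_le_power) auto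
    then have "C * (real n)\<^sup>2 \<le> ?a * (real n)\<^sup>2" by (intro mult_right_mono) auto
    then show "\<bar>internal_path_length (T, w)\<bar> \<le> ?a * real n ^ 3"
      using internal_path_bounds[OF Tw] cube[OF n] by linarith
  qed (use meas(1)[of n] in measurable)
  have W: "AE x in \<M> n. \<bar>wiener_index x\<bar> \<le> ?a * real n ^ 3" if n: "n \<ge> 1" for n
  proof (rule AE_\<M>[OF n])
    show "\<bar>wiener_index (T, w)\<bar> \<le> ?a * real n ^ 3" if "grown b n T" "admissible b C w" for T w
      by (rule wiener_bounds[OF that])
  qed (use meas(2)[of n] in measurable)
  have large: "\<forall>\<^sub>F n :: nat in sequentially. 1 \<le> n * ln n" "\<forall>\<^sub>F n :: nat in sequentially. 1 \<le> (real n)\<^sup>2 * ln n"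
    by real_asymp+
  show "\<forall>\<^sub>F n in sequentially.
      measure (\<M> n) {x \<in> space (\<M> n). t * (LINT x|\<M> n. internal_path_length x)
          < \<bar>internal_path_length x - (LINT x|\<M> n. internal_path_length x)\<bar>}
        \<le> exp (- (?K * \<mu> / 4 * t) * ln n * ln (ln n))"
  proof (rule tail_about_mean[OF prob_space_\<M> meas(1) pos(1) mu_pos pos(2) _ _ centred_tails(1) t])
    show "\<forall>\<^sub>F n in sequentially. AE x in \<M> n. \<bar>internal_path_length x\<bar> \<le> ?a * real n ^ 3"
      using eventually_ge_at_top[of 1] by eventually_elim (rule P)
    show "\<forall>\<^sub>F n in sequentially. \<bar>centre n\<bar> \<le> ?a * real n ^ 3 \<and> \<mu> * (n * ln n) \<le> centre n \<and> 1 \<le> n * ln n"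
      using eventually_ge_at_top[of 1] large(1)
    proof eventually_elim
      case (elim n)
      then show ?case using centre_bounds[of n] cube[of n] by auto
    qed
  qed
  show "\<forall>\<^sub>F n in sequentially.
      measure (\<M> n) {x \<in> space (\<M> n). t * (LINT x|\<M> n. wiener_index x)
          < \<bar>wiener_index x - (LINT x|\<M> n. wiener_index x)\<bar>}
        \<le> exp (- (?K * \<mu> / 4 * t) * ln n * ln (ln n))"
  proof (rule tail_about_mean[OF prob_space_\<M> meas(2) pos(1) mu_pos pos(2) _ _ centred_tails(2) t])
    show "\<forall>\<^sub>F n in sequentially. AE x in \<M> n. \<bar>wiener_index x\<bar> \<le> ?a * real n ^ 3"
      using eventually_ge_at_top[of 1] by eventually_elim (rule W)
    show "\<forall>\<^sub>F n in sequentially. \<bar>n * centre n\<bar> \<le> ?a * real n ^ 3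
        \<and> \<mu> * ((real n)\<^sup>2 * ln n) \<le> n * centre n \<and> 1 \<le> (real n)\<^sup>2 * ln n"
      using eventually_ge_at_top[of 1] large(2)
    proof eventually_elim
      case (elim n)
      have "n * centre n \<le> n * (?a * (real n)\<^sup>2)" "n * (\<mu> * (n * ln n)) \<le> n * centre n" "0 \<le> n * centre n"
        using centre_bounds[OF elim(1)] by (auto intro!: mult_left_mono)
      then show ?case
        using elim(2) by (simp add: power2_eq_square power3_eq_cube ac_simps)
    qed
  qed
qed

end

text \<open>
  Halving the rate leaves room to absorb the additive constants \<open>ln t + \<alpha>\<close> into \<open>ln (ln n)\<close>.
\<close>

lemma exponent_comparison:
  fixes \<beta> \<mu> D t \<alpha> K :: real
  assumes "0 < K" "0 < t" and q: "\<beta> * (\<mu> / D) = K / 2"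
  shows "\<forall>\<^sub>F n :: nat in sequentially. exp (- (K * t) * ln n * ln (ln n))
    \<le> exp (- (\<beta> * (\<mu> / D) * t * ln n * (ln (ln n) + ln t + \<alpha> + 0)))"
proof -
  have "\<forall>\<^sub>F n :: nat in sequentially. ln t + \<alpha> \<le> ln (ln n)" "\<forall>\<^sub>F n :: nat in sequentially. 0 \<le> ln n"
    by real_asymp+
  then show ?thesis
  proof eventually_elim
    case (elim n)
    have "K / 2 * t * ln n * (ln (ln n) + ln t + \<alpha>) \<le> K / 2 * t * ln n * (2 * ln (ln n))"
      using assms elim by (intro mult_left_mono) auto
    then show ?case unfolding q exp_le_cancel_iff by (simp add: algebra_simps)
  qed
qed

theorem corollary1p3:
  fixes b :: nat
    and N :: "'a measure"
    and Z :: "'a \<Rightarrow> nat \<Rightarrow> real"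
    and \<mu> :: real
  assumes b: "b \<ge> 2"
    and N: "prob_space N"
    and Z: "Z \<in> N \<rightarrow>\<^sub>M PiM {..<b} (\<lambda>_. borel)"
    and nonneg: "AE x in N. \<forall>i<b. 0 \<le> Z x i"
    and ident: "\<forall>i<b. \<forall>j<b. distr N borel (\<lambda>x. Z x i) = distr N borel (\<lambda>x. Z x j)"
    and bounded: "\<exists>C. AE x in N. L2_set (Z x) {..<b} \<le> C"
    and mu: "\<mu> = (LINT x|N. Z x 0)"
    and mu_pos: "\<mu> > 0"
  shows "\<exists>D>0.
    let \<alpha> = ln (b * \<mu> / (4 * D * (real b - 1) * exp 1));
        M = weighted_tree b (distr N (PiM {..<b} (\<lambda>_. borel)) Z)
    in \<forall>t>0.
      (\<exists>\<epsilon>::nat \<Rightarrow> real. \<epsilon> \<in> o(\<lambda>_. 1) \<and>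
        (\<forall>\<^sub>F n in sequentially.
          let EP = (LINT x|M n. internal_path_length x)
          in measure (M n) {x \<in> space (M n). \<bar>internal_path_length x - EP\<bar> > t * EP}
             \<le> exp (- (b / (real b - 1) * (\<mu> / D) * t * ln n * (ln (ln n) + ln t + \<alpha> + \<epsilon> n)))))
      \<and>
      (\<exists>\<epsilon>::nat \<Rightarrow> real. \<epsilon> \<in> o(\<lambda>_. 1) \<and>
        (\<forall>\<^sub>F n in sequentially.
          let EW = (LINT x|M n. wiener_index x)
          in measure (M n) {x \<in> space (M n). \<bar>wiener_index x - EW\<bar> > t * EW}
             \<le> exp (- (b / (real b - 1) * (\<mu> / D) * t * ln n * (ln (ln n) + ln t + \<alpha> + \<epsilon> n)))))"
proof -
  let ?B = "PiM {..<b} (\<lambda>_. borel :: real measure)"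
  define Q where "Q = distr N ?B Z"
  obtain C0 where C0: "AE x in N. L2_set (Z x) {..<b} \<le> C0"
    using bounded by blast
  define C where "C = max 1 C0"
  have coord: "(\<lambda>z. z i) \<in> borel_measurable ?B" if "i < b" for i
    using that by simp
  have ZC: "AE x in N. \<forall>i<b. 0 \<le> Z x i \<and> Z x i \<le> C"
    using nonneg C0
  proof eventually_elim
    case (elim x)
    have "Z x i \<le> L2_set (Z x) {..<b}" if "i < b" for i
      using that by (intro member_le_L2_set) auto
    then show ?case using elim unfolding C_def by fastforce
  qed
  have "weighted_recursive_tree b Q C \<mu>"
  proof (rule weighted_recursive_tree.intro)
    show "2 \<le> b" "0 < \<mu>" "1 \<le> C" using b mu_pos by (auto simp: C_def)
    show "prob_space Q" unfolding Q_def by (rule prob_space.prob_space_distr[OF N Z])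
    show "sets Q = sets ?B" by (simp add: Q_def)
    show "AE z in Q. \<forall>i<b. 0 \<le> z i \<and> z i \<le> C"
      unfolding Q_def
    proof (subst AE_distr_iff[OF Z])
      have "{z \<in> space ?B. \<forall>i\<in>{..<b}. 0 \<le> z i \<and> z i \<le> C} \<in> sets ?B"
        by measurable
      then show "{z \<in> space ?B. \<forall>i<b. 0 \<le> z i \<and> z i \<le> C} \<in> sets ?B"
        by (simp add: Ball_def)
    qed (rule ZC)
    show "(LINT z|Q. z i) = \<mu>" if i: "i < b" for i
    proof -
      have meas: "(\<lambda>x. Z x j) \<in> borel_measurable N" if "j < b" for j
        using measurable_compose[OF Z coord[OF that]] .
      have "(LINT z|Q. z i) = (LINT x|N. Z x i)"
        unfolding Q_def by (rule integral_distr[OF Z coord[OF i]])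
      also have "\<dots> = (LINT y|distr N borel (\<lambda>x. Z x i). y)"
        by (rule integral_distr[symmetric, OF meas[OF i]]) simp
      also have "\<dots> = (LINT y|distr N borel (\<lambda>x. Z x 0). y)"
        by (subst ident[rule_format, OF i, of 0]) (use b in simp_all)
      also have "\<dots> = (LINT x|N. Z x 0)"
        by (rule integral_distr[OF meas]) (use b in auto)
      finally show ?thesis by (simp add: mu)
    qed
  qed
  then interpret weighted_recursive_tree b Q C \<mu> .
  define K where "K = 1 / (8 * increment_bound\<^sup>2) * \<mu> / 4"
  have K: "0 < K" using increment_bound_ge(4) mu_pos by (simp add: K_def)
  \<comment> \<open>This makes the prefactor of the exponent equal to half of the rate \<open>K\<close>.\<close>
  define D where "D = 2 * (b / (real b - 1)) * \<mu> / K"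
  have D: "0 < D" "b / (real b - 1) * (\<mu> / D) = K / 2"
    using b mu_pos K by (auto simp: D_def field_simps)
  show ?thesis
  proof (intro exI[of _ D] conjI D(1), unfold Let_def Q_def[symmetric], intro allI impI conjI)
    fix t :: real assume t: "0 < t"
    let ?\<alpha> = "ln (b * \<mu> / (4 * D * (real b - 1) * exp 1))"
    note compare = exponent_comparison[OF K t D(2), of ?\<alpha>]
    have zero: "(\<lambda>_ :: nat. 0 :: real) \<in> o(\<lambda>_. 1)" by simp
    show "\<exists>\<epsilon>::nat \<Rightarrow> real. \<epsilon> \<in> o(\<lambda>_. 1) \<and> (\<forall>\<^sub>F n in sequentially.
        measure (\<M> n) {x \<in> space (\<M> n). t * (LINT x|\<M> n. internal_path_length x)
            < \<bar>internal_path_length x - (LINT x|\<M> n. internal_path_length x)\<bar>}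
          \<le> exp (- (b / (real b - 1) * (\<mu> / D) * t * ln n * (ln (ln n) + ln t + ?\<alpha> + \<epsilon> n))))"
    proof (rule exI[of _ "\<lambda>_. 0"], rule conjI[OF zero])
      show "\<forall>\<^sub>F n in sequentially.
        measure (\<M> n) {x \<in> space (\<M> n). t * (LINT x|\<M> n. internal_path_length x)
            < \<bar>internal_path_length x - (LINT x|\<M> n. internal_path_length x)\<bar>}
          \<le> exp (- (b / (real b - 1) * (\<mu> / D) * t * ln n * (ln (ln n) + ln t + ?\<alpha> + 0)))"
        using tails_about_mean(1)[OF t, folded K_def] compare
        by eventually_elim (rule order_trans)
    qed
    show "\<exists>\<epsilon>::nat \<Rightarrow> real. \<epsilon> \<in> o(\<lambda>_. 1) \<and> (\<forall>\<^sub>F n in sequentially.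
        measure (\<M> n) {x \<in> space (\<M> n). t * (LINT x|\<M> n. wiener_index x)
            < \<bar>wiener_index x - (LINT x|\<M> n. wiener_index x)\<bar>}
          \<le> exp (- (b / (real b - 1) * (\<mu> / D) * t * ln n * (ln (ln n) + ln t + ?\<alpha> + \<epsilon> n))))"
    proof (rule exI[of _ "\<lambda>_. 0"], rule conjI[OF zero])
      show "\<forall>\<^sub>F n in sequentially.
        measure (\<M> n) {x \<in> space (\<M> n). t * (LINT x|\<M> n. wiener_index x)
            < \<bar>wiener_index x - (LINT x|\<M> n. wiener_index x)\<bar>}
          \<le> exp (- (b / (real b - 1) * (\<mu> / D) * t * ln n * (ln (ln n) + ln t + ?\<alpha> + 0)))"
        using tails_about_mean(2)[OF t, folded K_def] compare
        by eventually_elim (rule order_trans)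
    qed
  qed
qed

end
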